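(* Consider the large dimensional proportional regime in which $n,m,k_1,k_2$ are positive integers with $$\alpha=\lim_{n\to\infty}\frac{m}{n},\qquad \beta_1=\lim_{n\to\infty}\frac{k_1}{n},\qquad \beta_2=\lim_{n\to\infty}\frac{k_2}{n}.$$ Let each element of $\mathbf{h}\in\mathbb{R}^m$ and $\mathbf{g}\in\mathbb{R}^n$ be a standard normal random variable independent of any other randomness, and set $$L=\frac{1}{\sqrt{k_1k_2}}\max_{\mathbf{x}\in\mathcal{S}_{\mathbf{x}},\,\mathbf{y}\in\mathcal{S}_{\mathbf{y}}}\left(\mathbf{h}^T\mathbf{y}+\mathbf{g}^T\mathbf{x}\right).$$ Let $A\in\mathbb{R}^{m\times n}$ be comprised of independent standard normal entries and let $\xi$ be its largest average $k_1\times k_2$ submatrix value. Then $$\lim_{n\to\infty}\mathbb{E}\,\xi\sqrt{n}\ \le\ \lim_{n\to\infty}\mathbb{E}\,L\sqrt{n}=\frac{1}{\sqrt{\beta_1\beta_2}}\,\omega(\hat\nu_1,\hat\nu_2)=\frac{1}{\sqrt{\beta_1\beta_2}}\left(\frac{\alpha}{\sqrt{\beta_1}}\,\frac{e^{-\left(\mathrm{erfinv}\left(1-\frac{2\beta_1}{\alpha}\right)\right)^2}}{\sqrt{2\pi}}+\frac{1}{\sqrt{\beta_2}}\,\frac{e^{-\left(\mathrm{erfinv}(1-2\beta_2)\right)^2}}{\sqrt{2\pi}}\right).$$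
   Context: For $A\in\mathbb{R}^{m\times n}$, the largest average $k_1\times k_2$ submatrix value is $$\xi=\frac{1}{k_1k_2}\max_{\substack{I_1\subset\{1,\dots,m\},\ |I_1|=k_1\\ I_2\subset\{1,\dots,n\},\ |I_2|=k_2}}\ \sum_{i\in I_1,\,j\in I_2}A_{ij}.$$ Further, $\mathcal{S}_{\mathbf{x}}=\{\mathbf{x}\in\mathbb{R}^n:\ \mathbf{x}_i\in\{0,1/\sqrt{k_2}\}\text{ for all }i,\ \sum_{i=1}^n\mathbf{x}_i=\sqrt{k_2}\}$ and $\mathcal{S}_{\mathbf{y}}=\{\mathbf{y}\in\mathbb{R}^m:\ \mathbf{y}_i\in\{0,1/\sqrt{k_1}\}\text{ for all }i,\ \sum_{i=1}^m\mathbf{y}_i=\sqrt{k_1}\}$. The function $\omega$ is $$\omega(\nu_1,\nu_2)=-\frac{\alpha}{\sqrt{\beta_1}}I(\nu_1)+\nu_1\sqrt{\beta_1}-\frac{1}{\sqrt{\beta_2}}I(\nu_2)+\nu_2\sqrt{\beta_2},\qquad I(\nu)=\frac12\,\nu\,\mathrm{erfc}\left(\frac{\nu}{\sqrt2}\right)-\frac{e^{-\nu^2/2}}{\sqrt{2\pi}},$$ and $\hat\nu_1=\sqrt2\,\mathrm{erfinv}\left(1-\frac{2\beta_1}{\alpha}\right)$, $\hat\nu_2=\sqrt2\,\mathrm{erfinv}(1-2\beta_2)$. Here $\mathrm{erfinv}$ is the inverse of $\mathrm{erf}(x)=\frac{2}{\sqrt{\pi}}\int_0^xe^{-t^2}\,dt$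 and $\mathrm{erfc}=1-\mathrm{erf}$. *)

theory Defs
  imports "HOL-Probability.Probability"
begin

definition erf :: "real \<Rightarrow> real" where
  "erf x = 2 / sqrt pi * (LBINT t=0..x. exp (- t\<^sup>2))"

definition erfc :: "real \<Rightarrow> real" where
  "erfc x = 1 - erf x"

text \<open>
  The function \<open>erf\<close> is injective with range $(-1,1)$; outside that range the value of \<open>erfinv\<close> is
  unspecified.
\<close>
definition erfinv :: "real \<Rightarrow> real" where
  "erfinv = inv erf"

definition I_fun :: "real \<Rightarrow> real" where
  "I_fun \<nu> = 1 / 2 * \<nu> * erfc (\<nu> / sqrt 2) - exp (- (\<nu>\<^sup>2 / 2)) / sqrt (2 * pi)"

definition omega :: "real \<Rightarrow> real \<Rightarrow> real \<Rightarrow> real \<Rightarrow> real \<Rightarrow> real" where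
  "omega \<alpha> \<beta>1 \<beta>2 \<nu>1 \<nu>2 =
     - (\<alpha> / sqrt \<beta>1) * I_fun \<nu>1 + \<nu>1 * sqrt \<beta>1 - (1 / sqrt \<beta>2) * I_fun \<nu>2 + \<nu>2 * sqrt \<beta>2"

definition nu1_hat :: "real \<Rightarrow> real \<Rightarrow> real" where
  "nu1_hat \<alpha> \<beta>1 = sqrt 2 * erfinv (1 - 2 * \<beta>1 / \<alpha>)"

definition nu2_hat :: "real \<Rightarrow> real" where
  "nu2_hat \<beta>2 = sqrt 2 * erfinv (1 - 2 * \<beta>2)"

text \<open>
  Vectors of dimension $d$ are functions on \<open>{1..d}\<close>, extended by \<open>undefined\<close> elsewhere, and
  matrices are functions of two indices of which only those in \<open>{1..m} \<times> {1..n}\<close> matter.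
  The maxima below range over nonempty finite sets exactly when \<open>k\<^sub>1 \<le> m\<close> and \<open>k\<^sub>2 \<le> n\<close>
  (for positive \<open>k\<^sub>1\<close> and \<open>k\<^sub>2\<close>); otherwise \<open>Max\<close> of the empty set is an unspecified constant.
\<close>
definition max_avg_submatrix ::
  "nat \<Rightarrow> nat \<Rightarrow> nat \<Rightarrow> nat \<Rightarrow> (nat \<Rightarrow> nat \<Rightarrow> real) \<Rightarrow> real" where
  "max_avg_submatrix m n k1 k2 A =
     1 / (real k1 * real k2) *
     Max {\<Sum>i\<in>I1. \<Sum>j\<in>I2. A i j | I1 I2.
            I1 \<subseteq> {1..m} \<and> card I1 = k1 \<and> I2 \<subseteq> {1..n} \<and> card I2 = k2}"

definition flat_vectors :: "nat \<Rightarrow> nat \<Rightarrow> (nat \<Rightarrow> real) set" where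
  "flat_vectors d k =
     {x \<in> {1..d} \<rightarrow>\<^sub>E {0, 1 / sqrt (real k)}. (\<Sum>i=1..d. x i) = sqrt (real k)}"

definition decoupled_max ::
  "nat \<Rightarrow> nat \<Rightarrow> nat \<Rightarrow> nat \<Rightarrow> (nat \<Rightarrow> real) \<Rightarrow> (nat \<Rightarrow> real) \<Rightarrow> real" where
  "decoupled_max m n k1 k2 h g =
     1 / sqrt (real k1 * real k2) *
     Max {(\<Sum>i=1..m. h i * y i) + (\<Sum>j=1..n. g j * x j) | x y.
            x \<in> flat_vectors n k2 \<and> y \<in> flat_vectors m k1}"

end

theory Submission
  imports Defs "HOL-Real_Asymp.Real_Asymp"
begin

text \<open>
  The inequality is a Gaussian comparison. After multiplication by \<open>k1 k2\<close>, the entry sum over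
  \<open>I \<times> J\<close> has smaller increments than \<open>sqrt k2 * (\<Sum>i\<in>I. h i) + sqrt k1 * (\<Sum>j\<in>J. g j)\<close>, so
  Sudakov-Fernique bounds the expected maximum. Sudakov-Fernique itself is proved by a Lindeberg
  argument for the log-sum-exp function \<open>F\<close>, without integration by parts: a Gaussian vector is a
  sum of \<open>N\<close> independent copies of itself scaled by \<open>1 / sqrt N\<close>, adding one such copy with
  coefficient vectors \<open>a\<close> changes \<open>E F\<close> by \<open>1 / (2 N)\<close> times the sum of the variances of the
  \<open>a\<close> under the softmax weights, up to \<open>O(N powr (-3/2))\<close>, and these variances are averages of squared
  increments. Letting \<open>N\<close> grow compares \<open>E F\<close>, and rescaling turns \<open>F\<close> into the maximum.

  The decoupled maximum splits into two sums of the \<open>k\<close> largest among \<open>d\<close> independent normals. If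
  \<open>k / d\<close> tends to the tail probability at \<open>\<nu>\<close>, the \<open>k\<close> largest are nearly those exceeding \<open>\<nu>\<close>, whose
  sum has mean \<open>d\<close> times the density at \<open>\<nu>\<close>.
\<close>

section \<open>Gaussian smoothing of Lipschitz functions\<close>

text \<open>The maximum is not differentiable, and the usual remedy differentiates a Gaussian
  interpolation under the integral. Here a Gaussian vector becomes a list of coefficient vectors,
  one per independent normal, acting on functions by a composition of commuting one-dimensional
  smoothing operators. A Lipschitz bound in finitely many coordinates is all the regularity these
  operators ask for, and they preserve it with the same constant. The softmax variance appears
  because log-sum-exp has gradient p, the softmax vector, and Hessian diag(p) - p p^T. The expansion
  is uniform in the base point, so a one-step comparison survives any further smoothing. In the
  second half, the threshold \<nu> is the Lagrange multiplier for choosing exactly k indices. Since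
  \<open>- I_fun \<nu>\<close> is the mean excess of a standard normal over \<nu>,
  \<open>omega\<close> is, up to a factor, the limiting dual bound, and the two hat values are its
  stationary points.\<close>

interpretation std_normal: prob_space std_normal_distribution
  by (rule prob_space_normal_density) simp

interpretation std_normal_pair: pair_prob_space std_normal_distribution std_normal_distribution ..

lemma std_normal_integrable_power:
  "integrable std_normal_distribution (\<lambda>z. z ^ k)" "integrable std_normal_distribution (\<lambda>z. \<bar>z\<bar> ^ k)"
  by (auto simp: integrable_density integrable_std_normal_moment integrable_std_normal_moment_abs)

lemma std_normal_integrable_id [simp]:
  "integrable std_normal_distribution (\<lambda>z. z)" "integrable std_normal_distribution (\<lambda>z. \<bar>z\<bar>)"
  using std_normal_integrable_power[of 1] by simp_all

lemma std_normal_mean: "(\<integral>z. z \<partial>std_normal_distribution) = 0"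
  using integral_std_normal_moment_odd[of 0] by (simp add: integral_density)

lemma std_normal_second_moment: "(\<integral>z. z\<^sup>2 \<partial>std_normal_distribution) = 1"
  using integral_std_normal_moment_even[of 1] by (simp add: integral_density)

text \<open>The sum over \<open>S\<close> forces \<open>f\<close> to ignore all coordinates outside
  \<open>S\<close>, so for finite \<open>S\<close> it is a function of finitely many variables
  although its argument is a function on the whole type. The l1 norm lets coordinatewise errors
  simply add up.\<close>

definition lip_l1 :: "real \<Rightarrow> 's set \<Rightarrow> (('s \<Rightarrow> real) \<Rightarrow> real) \<Rightarrow> bool" where
  "lip_l1 c S f \<longleftrightarrow> 0 \<le> c \<and> (\<forall>v w. \<bar>f v - f w\<bar> \<le> c * (\<Sum>s\<in>S. \<bar>v s - w s\<bar>))"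

lemma lip_l1I:
  assumes "0 \<le> c" "\<And>v w. f v - f w \<le> c * (\<Sum>s\<in>S. \<bar>v s - w s\<bar>)"
  shows "lip_l1 c S f"
proof -
  have "f w - f v \<le> c * (\<Sum>s\<in>S. \<bar>v s - w s\<bar>)" for v w
    using assms(2)[of w v] by (simp add: abs_minus_commute)
  with assms show ?thesis
    unfolding lip_l1_def abs_le_iff by simp
qed

lemma lip_l1D: "lip_l1 c S f \<Longrightarrow> \<bar>f v - f w\<bar> \<le> c * (\<Sum>s\<in>S. \<bar>v s - w s\<bar>)"
  by (simp add: lip_l1_def)

lemma lip_l1_nonneg: "lip_l1 c S f \<Longrightarrow> 0 \<le> c"
  by (simp add: lip_l1_def)

text \<open>Continuity is meant in the product topology. It is the source of the measurability of
  Lipschitz functions along lines, planes and linear images.\<close>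

lemma continuous_lip_l1:
  assumes "lip_l1 c S f"
  shows "continuous_on UNIV f"
  unfolding continuous_on_def
proof
  fix w :: "'a \<Rightarrow> real"
  have "((\<lambda>v. v s) \<longlongrightarrow> w s) (at w)" for s
    by (rule continuous_on_product_coordinates[unfolded continuous_on_def, rule_format]) simp
  then have "((\<lambda>v. c * (\<Sum>s\<in>S. \<bar>v s - w s\<bar>)) \<longlongrightarrow> c * (\<Sum>s\<in>S. \<bar>w s - w s\<bar>)) (at w)"
    by (intro tendsto_intros)
  then have "((\<lambda>v. c * (\<Sum>s\<in>S. \<bar>v s - w s\<bar>)) \<longlongrightarrow> 0) (at w)"
    by simp
  then have "((\<lambda>v. f v - f w) \<longlongrightarrow> 0) (at w)"
    by (rule Lim_null_comparison[rotated]) (simp add: lip_l1D[OF assms])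
  then show "(f \<longlongrightarrow> f w) (at w)"
    by (simp add: LIM_zero_iff)
qed

lemma lip_l1_compose_continuous:
  assumes "lip_l1 c S f" "\<And>s. continuous_on UNIV (\<lambda>x. h x s)"
  shows "continuous_on UNIV (\<lambda>x. f (h x))"
  by (rule continuous_on_compose2[OF continuous_lip_l1[OF assms(1)]
        continuous_on_coordinatewise_then_product]) (auto intro: assms(2))

lemma lip_l1_bound:
  assumes "lip_l1 c S f"
  shows "\<bar>f (\<lambda>s. v s + x s)\<bar> \<le> \<bar>f v\<bar> + c * (\<Sum>s\<in>S. \<bar>x s\<bar>)"
  using lip_l1D[OF assms, of "\<lambda>s. v s + x s" v] by simp

text \<open>The heat operator in a single direction: the mean of \<open>f\<close> under the Gaussian
  centred at \<open>v\<close> with rank-one covariance \<open>a a^T\<close>.\<close>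

definition gsmooth :: "('s \<Rightarrow> real) \<Rightarrow> (('s \<Rightarrow> real) \<Rightarrow> real) \<Rightarrow> ('s \<Rightarrow> real) \<Rightarrow> real" where
  "gsmooth a f v = (\<integral>z. f (\<lambda>s. v s + z * a s) \<partial>std_normal_distribution)"

lemma gsmooth_integrable:
  assumes "lip_l1 c S f"
  shows "integrable std_normal_distribution (\<lambda>z. f (\<lambda>s. v s + z * a s))"
proof (rule Bochner_Integration.integrable_bound)
  show "integrable std_normal_distribution (\<lambda>z. \<bar>f v\<bar> + c * (\<Sum>s\<in>S. \<bar>z\<bar> * \<bar>a s\<bar>))"
    by simp
  have "continuous_on UNIV (\<lambda>z. f (\<lambda>s. v s + z * a s))"
    by (rule lip_l1_compose_continuous[OF assms]) (intro continuous_intros)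
  then show "(\<lambda>z. f (\<lambda>s. v s + z * a s)) \<in> borel_measurable std_normal_distribution"
    by (simp add: borel_measurable_continuous_onI)
  show "AE z in std_normal_distribution. norm (f (\<lambda>s. v s + z * a s))
          \<le> norm (\<bar>f v\<bar> + c * (\<Sum>s\<in>S. \<bar>z\<bar> * \<bar>a s\<bar>))"
  proof (rule AE_I2)
    fix z :: real
    show "norm (f (\<lambda>s. v s + z * a s)) \<le> norm (\<bar>f v\<bar> + c * (\<Sum>s\<in>S. \<bar>z\<bar> * \<bar>a s\<bar>))"
      using lip_l1_bound[OF assms, of v "\<lambda>s. z * a s"] by (simp add: abs_mult)
  qed
qed

lemma lip_l1_gsmooth:
  assumes "lip_l1 c S f"
  shows "lip_l1 c S (gsmooth a f)"
proof (rule lip_l1I)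
  fix v w :: "'a \<Rightarrow> real"
  have "gsmooth a f v - gsmooth a f w =
      (\<integral>z. f (\<lambda>s. v s + z * a s) - f (\<lambda>s. w s + z * a s) \<partial>std_normal_distribution)"
    unfolding gsmooth_def
    by (subst Bochner_Integration.integral_diff) (auto intro: gsmooth_integrable[OF assms])
  also have "\<dots> \<le> (\<integral>z. c * (\<Sum>s\<in>S. \<bar>v s - w s\<bar>) \<partial>std_normal_distribution)"
  proof (rule integral_mono)
    show "f (\<lambda>s. v s + z * a s) - f (\<lambda>s. w s + z * a s) \<le> c * (\<Sum>s\<in>S. \<bar>v s - w s\<bar>)" for z
      using lip_l1D[OF assms, of "\<lambda>s. v s + z * a s" "\<lambda>s. w s + z * a s"] by simp
  qed (auto intro!: gsmooth_integrable[OF assms])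
  finally show "gsmooth a f v - gsmooth a f w \<le> c * (\<Sum>s\<in>S. \<bar>v s - w s\<bar>)"
    by (simp add: std_normal.prob_space[simplified])
qed (use assms in \<open>simp add: lip_l1_def\<close>)

lemma gsmooth_mono:
  assumes "lip_l1 c S f" "lip_l1 d S g" "\<And>v. f v \<le> g v"
  shows "gsmooth a f v \<le> gsmooth a g v"
  unfolding gsmooth_def
  by (rule integral_mono[OF gsmooth_integrable[OF assms(1)] gsmooth_integrable[OF assms(2)] assms(3)])

lemma gsmooth_add_const:
  assumes "lip_l1 c S f"
  shows "gsmooth a (\<lambda>v. f v + e) v = gsmooth a f v + e"
  unfolding gsmooth_def using std_normal.prob_space
  by (subst Bochner_Integration.integral_add) (auto intro: gsmooth_integrable[OF assms])

text \<open>The absolute value of \<open>f\<close> is again Lipschitz, so its inner integral is a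
  \<open>gsmooth\<close>, hence Lipschitz and integrable in the outer variable. This is the
  condition for Fubini.\<close>

lemma gsmooth_pair_integrable:
  assumes "lip_l1 c S f"
  shows "integrable (std_normal_distribution \<Otimes>\<^sub>M std_normal_distribution)
           (\<lambda>(x, y). f (\<lambda>s. v s + x * a s + y * b s))"
proof (rule std_normal_pair.Fubini_integrable)
  have "continuous_on UNIV (\<lambda>p. f (\<lambda>s. v s + fst p * a s + snd p * b s))"
    by (rule lip_l1_compose_continuous[OF assms]) (intro continuous_intros)
  then have "(\<lambda>p. f (\<lambda>s. v s + fst p * a s + snd p * b s)) \<in> borel_measurable (borel \<Otimes>\<^sub>M borel)"
    unfolding borel_prod by (rule borel_measurable_continuous_onI)
  then show "(\<lambda>(x, y). f (\<lambda>s. v s + x * a s + y * b s)) \<in>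
      borel_measurable (std_normal_distribution \<Otimes>\<^sub>M std_normal_distribution)"
    by (simp add: case_prod_beta cong: measurable_cong_sets sets_pair_measure_cong)
  have *: "lip_l1 c S (\<lambda>v. \<bar>f v\<bar>)"
  proof (rule lip_l1I)
    show "\<bar>f v\<bar> - \<bar>f w\<bar> \<le> c * (\<Sum>s\<in>S. \<bar>v s - w s\<bar>)" for v w
      using lip_l1D[OF assms, of v w] by linarith
  qed (rule lip_l1_nonneg[OF assms])
  show "integrable std_normal_distribution (\<lambda>x. \<integral>y. norm (case (x, y) of (x, y) \<Rightarrow>
      f (\<lambda>s. v s + x * a s + y * b s)) \<partial>std_normal_distribution)"
    using gsmooth_integrable[OF lip_l1_gsmooth[OF *], of b v a] by (simp add: gsmooth_def)
  show "AE x in std_normal_distribution. integrable std_normal_distribution (\<lambda>y. case (x, y) of (x, y) \<Rightarrow>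
      f (\<lambda>s. v s + x * a s + y * b s))"
    using gsmooth_integrable[OF assms, of "\<lambda>s. v s + _ * a s" b] by simp
qed

lemma gsmooth_commute:
  assumes "lip_l1 c S f"
  shows "gsmooth a (gsmooth b f) = gsmooth b (gsmooth a f)"
proof
  fix v
  show "gsmooth a (gsmooth b f) v = gsmooth b (gsmooth a f) v"
    using std_normal_pair.Fubini_integral[OF gsmooth_pair_integrable[OF assms], of v a b]
    by (simp add: gsmooth_def add_ac)
qed

lemma std_normal_distributed_scale:
  assumes "distributed M lborel X std_normal_density" "p > 0" "prob_space M"
  shows "distributed M lborel (\<lambda>x. p * X x) (normal_density 0 p)"
  using prob_space.normal_density_affine[OF assms(3,1), of p 0] assms(2) by simp

text \<open>Variances of independent normals add. This lets many small steps in one direction merge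
  into a single large one. Strict positivity of \<open>p\<close> and \<open>q\<close> keeps all the
  normal densities involved nondegenerate.\<close>

lemma gsmooth_semigroup:
  assumes "lip_l1 c S f" "p > 0" "q > 0"
  shows "gsmooth (\<lambda>s. p * a s) (gsmooth (\<lambda>s. q * a s) f) = gsmooth (\<lambda>s. sqrt (p\<^sup>2 + q\<^sup>2) * a s) f"
proof
  fix v
  let ?N = "std_normal_distribution"
  let ?P = "?N \<Otimes>\<^sub>M ?N"
  have fst': "distr ?P ?N fst = ?N"
    by (rule std_normal.distr_pair_fst)
  have snd': "distr ?P ?N snd = ?N"
    by (subst std_normal_pair.distr_pair_swap)
      (simp add: distr_distr comp_def case_prod_beta fst')
  have lb: "distr ?P lborel X = distr ?P ?N X" for X
    by (rule distr_cong) auto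
  have fst: "distributed ?P lborel fst std_normal_density"
    unfolding distributed_def by (simp add: lb fst')
  have snd: "distributed ?P lborel snd std_normal_density"
    unfolding distributed_def by (simp add: lb snd')
  \<comment> \<open>The pair of projections is the identity on the product space, so its joint law
    is the product of its marginals.\<close>
  have "std_normal_pair.indep_var ?N fst ?N snd"
    unfolding std_normal_pair.indep_var_distribution_eq fst' snd' by (simp add: distr_id2)
  then have "std_normal_pair.indep_var borel ((\<lambda>x. p * x) \<circ> fst) borel ((\<lambda>x. q * x) \<circ> snd)"
    by (rule std_normal_pair.indep_var_compose) simp_all
  then have ind: "std_normal_pair.indep_var borel (\<lambda>x. p * fst x) borel (\<lambda>x. q * snd x)"
    by (simp add: comp_def)
  have sum: "distributed ?P lborel (\<lambda>x. p * fst x + q * snd x) (normal_density 0 (sqrt (p\<^sup>2 + q\<^sup>2)))"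
    using std_normal_pair.add_indep_normal[OF ind assms(2,3)
      std_normal_distributed_scale[OF fst assms(2) std_normal_pair.prob_space_axioms]
      std_normal_distributed_scale[OF snd assms(3) std_normal_pair.prob_space_axioms]] by simp
  have N: "distributed ?N lborel (\<lambda>x. x) std_normal_density"
    unfolding distributed_def by (auto intro: distr_id2)
  have pq: "sqrt (p\<^sup>2 + q\<^sup>2) > 0"
    using assms(2) by (simp add: add_pos_nonneg)
  have D: "distributed ?N lborel (\<lambda>x. sqrt (p\<^sup>2 + q\<^sup>2) * x) (normal_density 0 (sqrt (p\<^sup>2 + q\<^sup>2)))"
    by (rule std_normal_distributed_scale[OF N pq]) (rule std_normal.prob_space_axioms)
  have "continuous_on UNIV (\<lambda>z. f (\<lambda>s. v s + z * a s))"
    by (rule lip_l1_compose_continuous[OF assms(1)]) (intro continuous_intros)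
  then have [measurable]: "(\<lambda>z. f (\<lambda>s. v s + z * a s)) \<in> borel_measurable lborel"
    by (simp add: borel_measurable_continuous_onI)
  have "gsmooth (\<lambda>s. p * a s) (gsmooth (\<lambda>s. q * a s) f) v =
     (\<integral>x. f (\<lambda>s. v s + (p * fst x + q * snd x) * a s) \<partial>?P)"
    using std_normal_pair.integral_fst[OF gsmooth_pair_integrable[OF assms(1)], of v "\<lambda>s. p * a s" "\<lambda>s. q * a s"]
    by (simp add: gsmooth_def algebra_simps case_prod_unfold)
  also have "\<dots> = (\<integral>z. normal_density 0 (sqrt (p\<^sup>2 + q\<^sup>2)) z * f (\<lambda>s. v s + z * a s) \<partial>lborel)"
    by (rule distributed_integral[OF sum, symmetric]) auto
  also have "\<dots> = (\<integral>z. f (\<lambda>s. v s + (sqrt (p\<^sup>2 + q\<^sup>2) * z) * a s) \<partial>?N)"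
    by (rule distributed_integral[OF D]) auto
  finally show "gsmooth (\<lambda>s. p * a s) (gsmooth (\<lambda>s. q * a s) f) v = gsmooth (\<lambda>s. sqrt (p\<^sup>2 + q\<^sup>2) * a s) f v"
    by (simp add: gsmooth_def mult_ac)
qed

section \<open>The log-sum-exp function\<close>

definition softmax :: "'s set \<Rightarrow> ('s \<Rightarrow> real) \<Rightarrow> 's \<Rightarrow> real" where
  "softmax S v s = exp (v s) / (\<Sum>u\<in>S. exp (v u))"

definition log_sum_exp :: "'s set \<Rightarrow> ('s \<Rightarrow> real) \<Rightarrow> real" where
  "log_sum_exp S v = ln (\<Sum>s\<in>S. exp (v s))"

text \<open>For weights of total mass 1 this is the variance of \<open>a\<close>; at softmax weights
  it is the second derivative of \<open>log_sum_exp S\<close> in direction \<open>a\<close>.\<close>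

definition wvar :: "'s set \<Rightarrow> ('s \<Rightarrow> real) \<Rightarrow> ('s \<Rightarrow> real) \<Rightarrow> real" where
  "wvar S p a = (\<Sum>s\<in>S. p s * (a s)\<^sup>2) - (\<Sum>s\<in>S. p s * a s)\<^sup>2"

lemma exp_quadratic_remainder:
  assumes "\<bar>y\<bar> \<le> (2::real)"
  shows "\<bar>exp y - (1 + y + y\<^sup>2 / 2)\<bar> \<le> 2 * \<bar>y\<bar> ^ 3"
proof -
  obtain t where t: "\<bar>t\<bar> \<le> \<bar>y\<bar>" "exp y = (\<Sum>m<3. y ^ m / fact m) + exp t / fact 3 * y ^ 3"
    using Maclaurin_exp_le[of y 3] by auto
  have eq: "exp y - (1 + y + y\<^sup>2 / 2) = exp t / 6 * y ^ 3"
    using t(2) by (simp add: eval_nat_numeral)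
  have "\<bar>exp y - (1 + y + y\<^sup>2 / 2)\<bar> = exp t / 6 * \<bar>y\<bar> ^ 3"
    unfolding eq by (simp add: abs_mult power_abs)
  moreover have "exp t / 6 * \<bar>y\<bar> ^ 3 \<le> 2 * \<bar>y\<bar> ^ 3"
  proof (rule mult_right_mono)
    \<comment> \<open>The range of \<open>y\<close> gives at most e^2, which is below 9, and 9/6 is
      below the claimed constant 2.\<close>
    have "exp t \<le> exp 1 * exp 1"
      using t(1) assms by (simp flip: exp_add)
    also have "\<dots> \<le> 3 * 3"
      using exp_le by (intro mult_mono) auto
    finally show "exp t / 6 \<le> 2" by simp
  qed simp
  ultimately show ?thesis by simp
qed

lemma ln_1_plus_quadratic:
  assumes "0 \<le> (u::real)"
  shows "\<bar>ln (1 + u) - u\<bar> \<le> u\<^sup>2"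
proof (cases "u \<le> 1")
  case True
  then show ?thesis using abs_ln_one_plus_x_minus_x_bound_nonneg[of u] assms by simp
next
  case False
  then have "0 \<le> ln (1 + u)" "ln (1 + u) \<le> u" "u \<le> u\<^sup>2"
    using ln_add_one_self_le_self[of u] by (auto simp: power2_eq_square)
  then show ?thesis by linarith
qed

text \<open>The cumulant expansion to second order. Subtracting the mean \<mu> removes the linear
  term and leaves \<open>ln (1 + u)\<close> with \<open>u\<close> close to half the variance. The
  bound has to hold for every \<open>r\<close>, since it is later integrated over an unbounded
  normal variable. The constant 400 covers 16 + 324 for small \<open>r\<close> and the crude
  estimate for large \<open>r\<close>.\<close>

lemma log_mean_exp_expansion:
  fixes p x :: "'s \<Rightarrow> real"
  assumes S: "finite S" "S \<noteq> {}" and p: "\<And>s. s \<in> S \<Longrightarrow> 0 \<le> p s" "(\<Sum>s\<in>S. p s) = 1"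
    and x: "\<And>s. s \<in> S \<Longrightarrow> \<bar>x s\<bar> \<le> r"
  shows "\<bar>ln (\<Sum>s\<in>S. p s * exp (x s)) - (\<Sum>s\<in>S. p s * x s) - wvar S p x / 2\<bar> \<le> 400 * r ^ 3"
proof -
  define \<mu> where "\<mu> = (\<Sum>s\<in>S. p s * x s)"
  define y where "y s = x s - \<mu>" for s
  have r: "0 \<le> r" using S x by fastforce
  have avg: "(\<Sum>s\<in>S. p s * h s) \<le> c" if "\<And>s. s \<in> S \<Longrightarrow> h s \<le> c" for h and c :: real
  proof -
    have "(\<Sum>s\<in>S. p s * h s) \<le> (\<Sum>s\<in>S. p s * c)"
      using that p by (intro sum_mono mult_left_mono) auto
    then show ?thesis using p(2) by (simp flip: sum_distrib_right)
  qed
  have avg': "c \<le> (\<Sum>s\<in>S. p s * h s)" if "\<And>s. s \<in> S \<Longrightarrow> c \<le> h s" for h and c :: real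
    using avg[of "\<lambda>s. - h s" "- c"] that by (simp add: sum_negf)
  have \<mu>: "\<bar>\<mu>\<bar> \<le> r"
    using avg[of x r] avg'[of "-r" x] x unfolding \<mu>_def by (fastforce simp: abs_le_iff)
  have y: "\<bar>y s\<bar> \<le> 2 * r" if "s \<in> S" for s
    using x[OF that] \<mu> unfolding y_def by linarith
  have sum_y: "(\<Sum>s\<in>S. p s * y s) = 0"
    using p(2) by (simp add: y_def right_diff_distrib sum_subtractf \<mu>_def flip: sum_distrib_right)
  have var: "(\<Sum>s\<in>S. p s * (y s)\<^sup>2) = wvar S p x"
  proof -
    have "(\<Sum>s\<in>S. p s * (y s)\<^sup>2) = (\<Sum>s\<in>S. p s * (x s)\<^sup>2 - 2 * \<mu> * (p s * x s) + \<mu>\<^sup>2 * p s)"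
      by (intro sum.cong) (auto simp: y_def power2_eq_square algebra_simps)
    also have "\<dots> = (\<Sum>s\<in>S. p s * (x s)\<^sup>2) - 2 * \<mu> * \<mu> + \<mu>\<^sup>2 * 1"
      unfolding \<mu>_def p(2)[symmetric] by (simp add: sum.distrib sum_subtractf sum_distrib_left)
    finally show ?thesis by (simp add: wvar_def \<mu>_def power2_eq_square)
  qed
  have var_le: "wvar S p x \<le> 4 * r\<^sup>2"
    unfolding var[symmetric]
  proof (rule avg)
    fix s assume "s \<in> S"
    then have "\<bar>y s\<bar>\<^sup>2 \<le> (2 * r)\<^sup>2" by (intro power_mono y) auto
    then show "(y s)\<^sup>2 \<le> 4 * r\<^sup>2" by (simp add: power_mult_distrib)
  qed
  have var_nn: "0 \<le> wvar S p x"
    unfolding var[symmetric] by (intro avg') auto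
  define u where "u = (\<Sum>s\<in>S. p s * exp (y s)) - 1"
  \<comment> \<open>Jensen's inequality for the exponential, obtained from its tangent at 0 because
    the weighted mean of \<open>y\<close> vanishes.\<close>
  have u0: "0 \<le> u"
  proof -
    have "(\<Sum>s\<in>S. p s * (1 + y s)) \<le> (\<Sum>s\<in>S. p s * exp (y s))"
      using p(1) by (intro sum_mono mult_left_mono) (auto intro: exp_ge_add_one_self)
    then show ?thesis using p(2) sum_y by (simp add: u_def distrib_left sum.distrib)
  qed
  have "(\<Sum>s\<in>S. p s * exp (x s)) = exp \<mu> * (1 + u)"
    by (simp add: u_def y_def exp_diff sum_distrib_left)
  then have ln_eq: "ln (\<Sum>s\<in>S. p s * exp (x s)) - \<mu> = ln (1 + u)"
    using u0 by (simp add: ln_mult)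
  show ?thesis
  proof (cases "r \<le> 1")
    case True
    \<comment> \<open>For small \<open>r\<close> the Taylor remainder of the exponential contributes
      \<open>16 * r ^ 3\<close>, so \<open>u\<close> is at most \<open>18 * r ^ 2\<close>, and its
      square at most \<open>324 * r ^ 4\<close>, which is below \<open>324 * r ^ 3\<close>.\<close>
    have r4: "r ^ 4 \<le> r ^ 3" using True r by (intro power_decreasing) auto
    have r3: "r ^ 3 \<le> r ^ 2" using True r by (intro power_decreasing) auto
    have "u - wvar S p x / 2 = (\<Sum>s\<in>S. p s * (exp (y s) - (1 + y s + (y s)\<^sup>2 / 2)))"
      using p(2) sum_y by (simp add: u_def var[symmetric] distrib_left right_diff_distrib
          sum_subtractf sum.distrib flip: sum_divide_distrib)
    also have "\<bar>\<dots>\<bar> \<le> 16 * r ^ 3"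
    proof -
      have *: "\<bar>exp (y s) - (1 + y s + (y s)\<^sup>2 / 2)\<bar> \<le> 16 * r ^ 3" if "s \<in> S" for s
      proof -
        have "\<bar>exp (y s) - (1 + y s + (y s)\<^sup>2 / 2)\<bar> \<le> 2 * \<bar>y s\<bar> ^ 3"
          using y[OF that] True by (intro exp_quadratic_remainder) auto
        also have "\<dots> \<le> 2 * (2 * r) ^ 3"
          using y[OF that] by (intro mult_left_mono power_mono) auto
        finally show ?thesis by (simp add: power_mult_distrib)
      qed
      show ?thesis
        using avg[OF *[THEN abs_le_D1]] avg[of "\<lambda>s. - (exp (y s) - (1 + y s + (y s)\<^sup>2 / 2))", OF *[THEN abs_le_D2]]
        unfolding mult_minus_right sum_negf by (rule abs_leI)
    qed
    finally have 1: "\<bar>u - wvar S p x / 2\<bar> \<le> 16 * r ^ 3" .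
    have "u \<le> 18 * r ^ 2" using 1 var_le r3 by linarith
    then have "u\<^sup>2 \<le> (18 * r ^ 2)\<^sup>2" using u0 by (intro power_mono) auto
    then have "u\<^sup>2 \<le> 324 * r ^ 3" using r4 by (simp add: power_mult_distrib)
    moreover have "\<bar>ln (1 + u) - u\<bar> \<le> u\<^sup>2" by (rule ln_1_plus_quadratic[OF u0])
    moreover have "0 \<le> r ^ 3" using r by simp
    ultimately show ?thesis
      using 1 ln_eq unfolding \<mu>_def[symmetric] by linarith
  next
    case False
    \<comment> \<open>For \<open>r > 1\<close> crude bounds suffice: the logarithm lies between 0
      and \<open>2 * r\<close>, half the variance between 0 and \<open>2 * r ^ 2\<close>, and
      \<open>r ^ 3\<close> dominates both powers.\<close>
    have "1 + u \<le> exp (2 * r)"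
      unfolding u_def using y by (simp add: avg abs_le_iff)
    then have "ln (1 + u) \<le> 2 * r"
      using u0 ln_le_cancel_iff[of "1 + u" "exp (2 * r)"] by simp
    moreover have "0 \<le> ln (1 + u)" using u0 by simp
    moreover have "r \<le> r ^ 3" "r ^ 2 \<le> r ^ 3"
      using False power_increasing[of 1 3 r] power_increasing[of 2 3 r] by auto
    ultimately show ?thesis
      using ln_eq var_le var_nn unfolding \<mu>_def[symmetric] by linarith
  qed
qed

lemma sum_exp_pos: "finite S \<Longrightarrow> S \<noteq> {} \<Longrightarrow> (\<Sum>s\<in>S. exp (v s :: real)) > 0"
  by (simp add: sum_pos)

lemma softmax_nonneg: "0 \<le> softmax S v s"
  by (simp add: softmax_def sum_nonneg)

lemma softmax_sum:
  assumes "finite S" "S \<noteq> {}" shows "(\<Sum>s\<in>S. softmax S v s) = 1"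
  using sum_exp_pos[OF assms, of v] by (simp add: softmax_def flip: sum_divide_distrib)

lemma softmax_le_1:
  assumes "finite S" "s \<in> S" shows "softmax S v s \<le> 1"
  using softmax_sum[of S v] member_le_sum[of s S "softmax S v"] assms softmax_nonneg[of S v]
  by (metis empty_iff)

text \<open>A move of l1 size \<open>d\<close> changes numerator and denominator each by a factor of
  at most \<open>exp d\<close>, hence the quotient by at most \<open>exp (2 * d)\<close>. As the
  quotient is at most 1, the additive change is at most \<open>1 - exp (- 2 * d)\<close>, which is
  below \<open>2 * d\<close>.\<close>

lemma softmax_lipschitz:
  assumes "finite S" "s \<in> S"
  shows "\<bar>softmax S v s - softmax S w s\<bar> \<le> 2 * (\<Sum>s\<in>S. \<bar>v s - w s\<bar>)"
proof -
  define d where "d = (\<Sum>s\<in>S. \<bar>v s - w s\<bar>)"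
  have ne: "S \<noteq> {}" using assms by auto
  have vw: "v u \<le> d + w u" "w u \<le> d + v u" if "u \<in> S" for u
    using member_le_sum[of u S "\<lambda>s. \<bar>v s - w s\<bar>"] assms that unfolding d_def by auto
  have le: "exp (- 2 * d) * softmax S v' s \<le> softmax S w' s"
    if "\<And>u. u \<in> S \<Longrightarrow> v' u \<le> d + w' u" "\<And>u. u \<in> S \<Longrightarrow> w' u \<le> d + v' u" for v' w'
  proof -
    have "(\<Sum>u\<in>S. exp (w' u)) \<le> exp d * (\<Sum>u\<in>S. exp (v' u))"
      unfolding sum_distrib_left exp_add[symmetric] using that by (intro sum_mono) auto
    moreover have "exp (v' s) \<le> exp d * exp (w' s)"
      using that assms(2) by (simp flip: exp_add)
    ultimately have "exp (v' s) * (\<Sum>u\<in>S. exp (w' u)) \<le>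
        (exp d * exp (w' s)) * (exp d * (\<Sum>u\<in>S. exp (v' u)))"
      by (intro mult_mono) (auto intro: sum_nonneg)
    then have "exp (- 2 * d) * (exp (v' s) * (\<Sum>u\<in>S. exp (w' u))) \<le>
        exp (- 2 * d) * ((exp d * exp (w' s)) * (exp d * (\<Sum>u\<in>S. exp (v' u))))"
      by (rule mult_left_mono) simp
    also have "\<dots> = (exp (- 2 * d) * (exp d * exp d)) * (exp (w' s) * (\<Sum>u\<in>S. exp (v' u)))"
      by (simp only: mult_ac)
    also have "exp (- 2 * d) * (exp d * exp d) = 1"
      by (simp flip: exp_add)
    finally have "exp (- 2 * d) * (exp (v' s) * (\<Sum>u\<in>S. exp (w' u))) \<le>
        exp (w' s) * (\<Sum>u\<in>S. exp (v' u))"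
      by simp
    then show ?thesis
      using sum_exp_pos[OF assms(1) ne] by (simp add: softmax_def field_simps)
  qed
  have diff: "softmax S v' s - softmax S w' s \<le> 2 * d"
    if "exp (- 2 * d) * softmax S v' s \<le> softmax S w' s" for v' w'
  proof -
    have "d \<ge> 0" by (simp add: d_def sum_nonneg)
    have "softmax S v' s * (1 - 2 * d) \<le> softmax S v' s * exp (- 2 * d)"
      using exp_ge_add_one_self[of "- 2 * d"] softmax_nonneg by (intro mult_left_mono) auto
    moreover have "softmax S v' s * (2 * d) \<le> 1 * (2 * d)"
      using softmax_le_1[OF assms] \<open>d \<ge> 0\<close> by (intro mult_right_mono) auto
    ultimately show ?thesis using that by (simp add: algebra_simps)
  qed
  have "softmax S v s - softmax S w s \<le> 2 * d" "softmax S w s - softmax S v s \<le> 2 * d"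
    by (rule diff[OF le]; simp add: vw)+
  then show ?thesis
    unfolding d_def[symmetric] by linarith
qed

text \<open>The increment is a log-mean-exp under the softmax weights at \<open>v\<close>, which is
  the form expanded in \<open>log_mean_exp_expansion\<close>.\<close>

lemma log_sum_exp_add:
  assumes "finite S" "S \<noteq> {}"
  shows "log_sum_exp S (\<lambda>s. v s + x s) = log_sum_exp S v + ln (\<Sum>s\<in>S. softmax S v s * exp (x s))"
proof -
  have "(\<Sum>s\<in>S. softmax S v s * exp (x s)) = (\<Sum>s\<in>S. exp (v s + x s)) / (\<Sum>s\<in>S. exp (v s))"
    by (simp add: softmax_def exp_add sum_divide_distrib)
  then show ?thesis
    using sum_exp_pos[OF assms, THEN less_imp_neq, THEN not_sym] by (simp add: log_sum_exp_def ln_div)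
qed

lemma log_sum_exp_expansion:
  assumes S: "finite S" "S \<noteq> {}" and x: "\<And>s. s \<in> S \<Longrightarrow> \<bar>x s\<bar> \<le> r"
  shows "\<bar>log_sum_exp S (\<lambda>s. v s + x s) - (log_sum_exp S v + (\<Sum>s\<in>S. softmax S v s * x s)
            + wvar S (softmax S v) x / 2)\<bar> \<le> 400 * r ^ 3"
proof -
  have "\<bar>ln (\<Sum>s\<in>S. softmax S v s * exp (x s)) - (\<Sum>s\<in>S. softmax S v s * x s)
      - wvar S (softmax S v) x / 2\<bar> \<le> 400 * r ^ 3"
    using x by (intro log_mean_exp_expansion S softmax_nonneg softmax_sum) auto
  then show ?thesis
    unfolding log_sum_exp_add[OF S] by linarith
qed

lemma lip_log_sum_exp:
  assumes S: "finite S" "S \<noteq> {}"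
  shows "lip_l1 1 S (log_sum_exp S)"
proof (rule lip_l1I)
  fix v w :: "'a \<Rightarrow> real"
  let ?d = "\<Sum>s\<in>S. \<bar>v s - w s\<bar>"
  have "v s \<le> ?d + w s" if "s \<in> S" for s
    using member_le_sum[of s S "\<lambda>s. \<bar>v s - w s\<bar>"] S that by auto
  then have "(\<Sum>s\<in>S. exp (v s)) \<le> exp ?d * (\<Sum>s\<in>S. exp (w s))"
    unfolding sum_distrib_left exp_add[symmetric] by (intro sum_mono) auto
  then have "ln (\<Sum>s\<in>S. exp (v s)) \<le> ln (exp ?d * (\<Sum>s\<in>S. exp (w s)))"
    using sum_exp_pos[OF S] by simp
  also have "\<dots> = ?d + ln (\<Sum>s\<in>S. exp (w s))"
    using sum_exp_pos[OF S, of w] by (subst ln_mult) auto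
  finally show "log_sum_exp S v - log_sum_exp S w \<le> 1 * ?d"
    by (simp add: log_sum_exp_def)
qed simp

text \<open>When smoothings are composed, a later one also acts on the variance term left by the
  earlier ones. A Lipschitz bound of any size makes this change of order \<open>d\<close>, hence of
  third order after the factor \<open>d\<^sup>2 / 2\<close>.\<close>

lemma lip_wvar_softmax:
  assumes "finite S"
  shows "\<exists>c. lip_l1 c S (\<lambda>v. wvar S (softmax S v) a)"
proof -
  define R where "R = (\<Sum>s\<in>S. \<bar>a s\<bar>)"
  have R: "0 \<le> R" by (simp add: R_def sum_nonneg)
  have lin: "\<bar>(\<Sum>s\<in>S. softmax S v s * h s) - (\<Sum>s\<in>S. softmax S w s * h s)\<bar> \<le>
      2 * (\<Sum>s\<in>S. \<bar>v s - w s\<bar>) * (\<Sum>s\<in>S. \<bar>h s\<bar>)" for v w h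
  proof -
    have "\<bar>(\<Sum>s\<in>S. softmax S v s * h s) - (\<Sum>s\<in>S. softmax S w s * h s)\<bar> \<le>
        (\<Sum>s\<in>S. \<bar>(softmax S v s - softmax S w s) * h s\<bar>)"
      unfolding sum_subtractf[symmetric] left_diff_distrib[symmetric] by (rule sum_abs)
    also have "\<dots> \<le> (\<Sum>s\<in>S. 2 * (\<Sum>s\<in>S. \<bar>v s - w s\<bar>) * \<bar>h s\<bar>)"
      unfolding abs_mult using softmax_lipschitz[OF assms]
      by (intro sum_mono mult_right_mono) auto
    finally show ?thesis by (simp add: sum_distrib_left)
  qed
  have bd: "\<bar>\<Sum>s\<in>S. softmax S v s * a s\<bar> \<le> R" for v
  proof -
    have "\<bar>\<Sum>s\<in>S. softmax S v s * a s\<bar> \<le> (\<Sum>s\<in>S. \<bar>softmax S v s * a s\<bar>)" by (rule sum_abs)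
    also have "\<dots> \<le> (\<Sum>s\<in>S. 1 * \<bar>a s\<bar>)"
      unfolding abs_mult using softmax_le_1[OF assms] softmax_nonneg[of S v]
      by (intro sum_mono mult_right_mono) auto
    finally show ?thesis by (simp add: R_def)
  qed
  show ?thesis
  proof (intro exI lip_l1I)
    fix v w :: "'a \<Rightarrow> real"
    let ?d = "\<Sum>s\<in>S. \<bar>v s - w s\<bar>"
    let ?m = "\<lambda>v. \<Sum>s\<in>S. softmax S v s * a s"
    have "\<bar>(?m v)\<^sup>2 - (?m w)\<^sup>2\<bar> = \<bar>?m v - ?m w\<bar> * \<bar>?m v + ?m w\<bar>"
      by (simp add: power2_eq_square algebra_simps flip: abs_mult)
    also have "\<dots> \<le> (2 * ?d * R) * (2 * R)"
      using lin[of v a w] bd[of v] bd[of w] R unfolding R_def[symmetric]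
      by (intro mult_mono) (auto intro!: mult_nonneg_nonneg sum_nonneg)
    finally have "\<bar>(?m v)\<^sup>2 - (?m w)\<^sup>2\<bar> \<le> (2 * ?d * R) * (2 * R)" .
    with lin[of v "\<lambda>s. (a s)\<^sup>2" w]
    have "wvar S (softmax S v) a - wvar S (softmax S w) a \<le>
        2 * ?d * (\<Sum>s\<in>S. \<bar>(a s)\<^sup>2\<bar>) + (2 * ?d * R) * (2 * R)"
      unfolding wvar_def by linarith
    also have "\<dots> = (2 * (\<Sum>s\<in>S. \<bar>(a s)\<^sup>2\<bar>) + 4 * R * R) * ?d"
      by (simp add: algebra_simps)
    finally show "wvar S (softmax S v) a - wvar S (softmax S w) a \<le>
        (2 * (\<Sum>s\<in>S. \<bar>(a s)\<^sup>2\<bar>) + 4 * R * R) * ?d" .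
  qed (auto intro!: add_nonneg_nonneg mult_nonneg_nonneg sum_nonneg R)
qed

section \<open>Comparison of Gaussian maxima\<close>

lemma lip_l1_add:
  assumes "lip_l1 c S f" "lip_l1 d S g"
  shows "lip_l1 (c + d) S (\<lambda>v. f v + g v)"
proof (rule lip_l1I)
  fix v w :: "'a \<Rightarrow> real"
  show "(f v + g v) - (f w + g w) \<le> (c + d) * (\<Sum>s\<in>S. \<bar>v s - w s\<bar>)"
    using lip_l1D[OF assms(1), of v w] lip_l1D[OF assms(2), of v w]
    unfolding distrib_right by linarith
qed (use assms in \<open>simp add: lip_l1_def\<close>)

lemma lip_l1_cmult:
  assumes "lip_l1 c S f" "0 \<le> k"
  shows "lip_l1 (k * c) S (\<lambda>v. k * f v)"
proof (rule lip_l1I)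
  fix v w :: "'a \<Rightarrow> real"
  show "k * f v - k * f w \<le> (k * c) * (\<Sum>s\<in>S. \<bar>v s - w s\<bar>)"
    using mult_left_mono[OF order_trans[OF abs_ge_self lip_l1D[OF assms(1), of v w]] assms(2)]
    by (simp add: right_diff_distrib mult.assoc)
qed (use assms in \<open>simp add: lip_l1_def\<close>)

lemma lip_l1_const: "lip_l1 0 S (\<lambda>v. e)"
  by (simp add: lip_l1_def)

lemma gsmooth_add_cmult:
  assumes "lip_l1 c S f" "lip_l1 d S g"
  shows "gsmooth a (\<lambda>v. f v + k * g v) v = gsmooth a f v + k * gsmooth a g v"
  unfolding gsmooth_def
  by (subst Bochner_Integration.integral_add) (auto intro: gsmooth_integrable[OF assms(1)] gsmooth_integrable[OF assms(2)])

lemma gsmooth_abs_diff_le: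
  assumes f: "lip_l1 c S f" and g: "lip_l1 d S g" and "\<And>v. \<bar>f v - g v\<bar> \<le> e"
  shows "\<bar>gsmooth a f v - gsmooth a g v\<bar> \<le> e"
proof -
  have 1: "f v \<le> g v + e" "g v \<le> f v + e" for v using assms(3)[of v] by auto
  have 2: "lip_l1 (c + 0) S (\<lambda>v. f v + e)" "lip_l1 (d + 0) S (\<lambda>v. g v + e)"
    by (intro lip_l1_add lip_l1_const f g)+
  show ?thesis
    using gsmooth_mono[OF f 2(2) 1(1), of a v] gsmooth_mono[OF g 2(1) 1(2), of a v]
    unfolding gsmooth_add_const[OF f] gsmooth_add_const[OF g] by linarith
qed

lemma gsmooth_close:
  assumes "lip_l1 c S f"
  shows "\<bar>gsmooth a f v - f v\<bar> \<le> (\<integral>z. \<bar>z\<bar> \<partial>std_normal_distribution) * (c * (\<Sum>s\<in>S. \<bar>a s\<bar>))"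
proof -
  have "gsmooth a f v - f v = (\<integral>z. f (\<lambda>s. v s + z * a s) - f v \<partial>std_normal_distribution)"
    unfolding gsmooth_def using std_normal.prob_space
    by (subst Bochner_Integration.integral_diff) (auto intro: gsmooth_integrable[OF assms])
  also have "\<bar>\<dots>\<bar> \<le> (\<integral>z. \<bar>f (\<lambda>s. v s + z * a s) - f v\<bar> \<partial>std_normal_distribution)"
    by (rule integral_abs_bound)
  also have "\<dots> \<le> (\<integral>z. \<bar>z\<bar> * (c * (\<Sum>s\<in>S. \<bar>a s\<bar>)) \<partial>std_normal_distribution)"
  proof (rule integral_mono)
    show "\<bar>f (\<lambda>s. v s + z * a s) - f v\<bar> \<le> \<bar>z\<bar> * (c * (\<Sum>s\<in>S. \<bar>a s\<bar>))" for z
      using lip_l1D[OF assms, of "\<lambda>s. v s + z * a s" v]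
      by (simp add: abs_mult sum_distrib_left[symmetric] mult_ac)
  qed (auto intro!: gsmooth_integrable[OF assms])
  finally show ?thesis by simp
qed

section \<open>Iterated smoothing: a list of coefficient vectors stands for a Gaussian
  vector\<close>

abbreviation gsmooths :: "('s \<Rightarrow> real) list \<Rightarrow> (('s \<Rightarrow> real) \<Rightarrow> real) \<Rightarrow> ('s \<Rightarrow> real) \<Rightarrow> real" where
  "gsmooths \<equiv> foldr gsmooth"

definition scale_vecs :: "real \<Rightarrow> ('s \<Rightarrow> real) list \<Rightarrow> ('s \<Rightarrow> real) list" where
  "scale_vecs r L = map (\<lambda>a s. r * a s) L"

lemma scale_vecs_simps [simp]:
  "scale_vecs r [] = []" "scale_vecs r (a # L) = (\<lambda>s. r * a s) # scale_vecs r L" "scale_vecs 1 L = L"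
  by (simp_all add: scale_vecs_def)

lemma lip_l1_gsmooths: "lip_l1 c S f \<Longrightarrow> lip_l1 c S (gsmooths L f)"
  by (induction L) (auto intro: lip_l1_gsmooth)

lemma gsmooths_mono:
  assumes "lip_l1 c S f" "lip_l1 d S g" "\<And>v. f v \<le> g v"
  shows "gsmooths L f v \<le> gsmooths L g v"
proof (induction L arbitrary: v)
  case (Cons a L)
  show ?case
    using gsmooth_mono[OF lip_l1_gsmooths[OF assms(1)] lip_l1_gsmooths[OF assms(2)] Cons.IH] by simp
qed (simp add: assms)

lemma gsmooths_add_const:
  assumes "lip_l1 c S f"
  shows "gsmooths L (\<lambda>v. f v + e) v = gsmooths L f v + e"
proof (induction L arbitrary: v)
  case (Cons a L)
  then have "gsmooths L (\<lambda>v. f v + e) = (\<lambda>v. gsmooths L f v + e)" by auto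
  then show ?case using gsmooth_add_const[OF lip_l1_gsmooths[OF assms]] by simp
qed simp

lemma gsmooth_gsmooths:
  "lip_l1 c S f \<Longrightarrow> gsmooth a (gsmooths L f) = gsmooths L (gsmooth a f)"
proof (induction L)
  case (Cons b L)
  then show ?case using gsmooth_commute[OF lip_l1_gsmooths[OF Cons.prems], of a b L] by simp
qed simp

lemma gsmooths_commute:
  "lip_l1 c S f \<Longrightarrow> gsmooths L (gsmooths L' f) = gsmooths L' (gsmooths L f)"
  by (induction L) (simp_all add: gsmooth_gsmooths[OF lip_l1_gsmooths])

text \<open>Smoothings commute, so the two lists can be interleaved and merged direction by
  direction.\<close>

lemma gsmooths_semigroup:
  assumes "lip_l1 c S f" "p > 0" "q > 0"
  shows "gsmooths (scale_vecs p L) (gsmooths (scale_vecs q L) f) = gsmooths (scale_vecs (sqrt (p\<^sup>2 + q\<^sup>2)) L) f"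
proof (induction L)
  case (Cons a L)
  have "gsmooths (scale_vecs p (a # L)) (gsmooths (scale_vecs q (a # L)) f) =
     gsmooth (\<lambda>s. p * a s) (gsmooths (scale_vecs p L) (gsmooth (\<lambda>s. q * a s) (gsmooths (scale_vecs q L) f)))"
    by simp
  also have "\<dots> = gsmooth (\<lambda>s. p * a s) (gsmooth (\<lambda>s. q * a s) (gsmooths (scale_vecs p L) (gsmooths (scale_vecs q L) f)))"
    by (simp add: gsmooth_gsmooths[OF lip_l1_gsmooths[OF assms(1)]])
  also have "\<dots> = gsmooth (\<lambda>s. sqrt (p\<^sup>2 + q\<^sup>2) * a s) (gsmooths (scale_vecs p L) (gsmooths (scale_vecs q L) f))"
    by (rule gsmooth_semigroup[OF lip_l1_gsmooths[OF lip_l1_gsmooths[OF assms(1)]] assms(2,3)])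
  finally show ?case by (simp add: Cons.IH)
qed simp

lemma gsmooths_replicate:
  assumes "lip_l1 c S f" "d > 0" "N > 0"
  shows "gsmooths (concat (replicate N (scale_vecs d L))) f = gsmooths (scale_vecs (sqrt (real N) * d) L) f"
  using \<open>N > 0\<close>
proof (induction N rule: nat_induct_non_zero)
  case (Suc N)
  have "sqrt (d\<^sup>2 + (sqrt (real N) * d)\<^sup>2) = sqrt (real (Suc N) * d\<^sup>2)"
    by (simp add: power_mult_distrib algebra_simps)
  also have "\<dots> = sqrt (real (Suc N)) * d"
    using assms(2) by (simp only: real_sqrt_mult real_sqrt_abs)
  finally show ?case
    using gsmooths_semigroup[OF assms(1,2), of "sqrt (real N) * d" L] Suc assms(2) by simp
qed simp

text \<open>The operators commute, so in \<open>N\<close> steps the one-step errors \<open>\<epsilon>\<close> only add up.\<close>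
lemma gsmooths_replicate_le:
  assumes f: "lip_l1 c S f" and le: "\<And>v. gsmooths L f v \<le> gsmooths L' f v + \<epsilon>"
  shows "gsmooths (concat (replicate N L)) f v \<le> gsmooths (concat (replicate N L')) f v + real N * \<epsilon>"
proof (induction N arbitrary: v)
  case (Suc N)
  let ?A = "concat (replicate N L)" and ?B = "concat (replicate N L')"
  note lip = lip_l1_gsmooths[OF f]
  have "gsmooths L (gsmooths ?A f) v \<le> gsmooths L (\<lambda>v. gsmooths ?B f v + real N * \<epsilon>) v"
    using Suc.IH by (rule gsmooths_mono[OF lip lip_l1_add[OF lip lip_l1_const]])
  also have "\<dots> = gsmooths ?B (gsmooths L f) v + real N * \<epsilon>"
    by (simp add: gsmooths_add_const[OF lip] gsmooths_commute[OF f, of L])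
  also have "gsmooths ?B (gsmooths L f) v \<le> gsmooths ?B (\<lambda>v. gsmooths L' f v + \<epsilon>) v"
    using le by (rule gsmooths_mono[OF lip lip_l1_add[OF lip lip_l1_const]])
  also have "\<dots> = gsmooths L' (gsmooths ?B f) v + \<epsilon>"
    by (simp add: gsmooths_add_const[OF lip] gsmooths_commute[OF f, of L'])
  finally show ?case by (simp add: algebra_simps)
qed simp

section \<open>Second-order expansion and comparison for log-sum-exp\<close>

lemma wvar_scale: "wvar S p (\<lambda>s. r * a s) = r\<^sup>2 * wvar S p a"
proof -
  have 1: "(\<Sum>s\<in>S. p s * (r * a s)) = r * (\<Sum>s\<in>S. p s * a s)"
    by (simp add: sum_distrib_left mult_ac)
  have 2: "(\<Sum>s\<in>S. p s * (r * a s)\<^sup>2) = r\<^sup>2 * (\<Sum>s\<in>S. p s * (a s)\<^sup>2)"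
    by (simp add: sum_distrib_left power_mult_distrib mult_ac)
  show ?thesis
    unfolding wvar_def 1 2 by (simp add: power_mult_distrib right_diff_distrib)
qed

text \<open>Integrating the pointwise expansion over \<open>z\<close>: mean 0 kills the linear term,
  second moment 1 leaves half the variance, and the third absolute moment bounds the remainder.
  \<open>C\<close> is independent of \<open>v\<close>, so the estimate can be smoothed
  again.\<close>

lemma gsmooth_log_sum_exp_expansion:
  assumes S: "finite S" "S \<noteq> {}"
  shows "\<exists>C\<ge>0. \<forall>d\<ge>0. \<forall>v. \<bar>gsmooth (\<lambda>s. d * a s) (log_sum_exp S) v -
           (log_sum_exp S v + d\<^sup>2 / 2 * wvar S (softmax S v) a)\<bar> \<le> C * d ^ 3"
proof (intro exI conjI allI impI)
  let ?N = "std_normal_distribution"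
  let ?C = "400 * (\<Sum>s\<in>S. \<bar>a s\<bar>) ^ 3 * (\<integral>z. \<bar>z\<bar> ^ 3 \<partial>?N)"
  show "0 \<le> ?C" by (intro mult_nonneg_nonneg zero_le_power sum_nonneg integral_nonneg) auto
  fix d :: real and v :: "'a \<Rightarrow> real" assume d: "0 \<le> d"
  define m W where "m = (\<Sum>s\<in>S. softmax S v s * a s)" and "W = wvar S (softmax S v) a"
  define D where "D z = log_sum_exp S (\<lambda>s. v s + z * (d * a s)) -
      (log_sum_exp S v + z * (d * m) + z\<^sup>2 * (d\<^sup>2 / 2 * W))" for z
  note int = gsmooth_integrable[OF lip_log_sum_exp[OF S], of v "\<lambda>s. d * a s"]
  note int2 = std_normal_integrable_power(1)[of 2]
  have D: "\<bar>D z\<bar> \<le> \<bar>z\<bar> ^ 3 * (400 * (\<Sum>s\<in>S. \<bar>a s\<bar>) ^ 3 * d ^ 3)" for z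
  proof -
    have "\<bar>z * (d * a s)\<bar> \<le> \<bar>z\<bar> * (d * (\<Sum>s\<in>S. \<bar>a s\<bar>))" if "s \<in> S" for s
      using member_le_sum[of s S "\<lambda>s. \<bar>a s\<bar>"] S that d
      by (auto simp: abs_mult intro!: mult_left_mono)
    from log_sum_exp_expansion[OF S this]
    have "\<bar>log_sum_exp S (\<lambda>s. v s + z * (d * a s)) - (log_sum_exp S v + (\<Sum>s\<in>S. softmax S v s * (z * (d * a s)))
            + wvar S (softmax S v) (\<lambda>s. z * (d * a s)) / 2)\<bar> \<le> 400 * (\<bar>z\<bar> * (d * (\<Sum>s\<in>S. \<bar>a s\<bar>))) ^ 3" .
    moreover have "(\<Sum>s\<in>S. softmax S v s * (z * (d * a s))) = z * (d * m)"
      by (simp add: m_def sum_distrib_left mult_ac)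
    moreover have "wvar S (softmax S v) (\<lambda>s. z * (d * a s)) / 2 = z\<^sup>2 * (d\<^sup>2 / 2 * W)"
      by (simp add: wvar_scale W_def)
    ultimately show ?thesis
      by (simp add: D_def power_mult_distrib mult_ac)
  qed
  have intD: "integrable ?N D"
    unfolding D_def using int int2 by simp
  have "(\<integral>z. D z \<partial>?N) = gsmooth (\<lambda>s. d * a s) (log_sum_exp S) v - (log_sum_exp S v + d\<^sup>2 / 2 * W)"
    unfolding D_def gsmooth_def using int int2 std_normal.prob_space
    by (simp add: std_normal_mean std_normal_second_moment)
  moreover have "\<bar>\<integral>z. D z \<partial>?N\<bar> \<le> (\<integral>z. \<bar>z\<bar> ^ 3 * (400 * (\<Sum>s\<in>S. \<bar>a s\<bar>) ^ 3 * d ^ 3) \<partial>?N)"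
    using intD D std_normal_integrable_power(2)[of 3]
    by (intro order_trans[OF integral_abs_bound] integral_mono) auto
  ultimately show "\<bar>gsmooth (\<lambda>s. d * a s) (log_sum_exp S) v -
      (log_sum_exp S v + d\<^sup>2 / 2 * wvar S (softmax S v) a)\<bar> \<le> ?C * d ^ 3"
    by (simp add: W_def mult_ac)
qed

text \<open>A new direction \<open>b\<close> brings three errors: the inherited one, which smoothing
  does not enlarge (\<open>C\<close>); the expansion of log-sum-exp along \<open>b\<close>
  (\<open>D\<close>); and the drift of the earlier variance term \<open>W\<close> when it is
  smoothed along \<open>b\<close> (\<open>E / 2\<close>).\<close>

lemma gsmooths_log_sum_exp_expansion:
  assumes S: "finite S" "S \<noteq> {}"
  shows "\<exists>C\<ge>0. \<forall>d\<in>{0..1}. \<forall>v. \<bar>gsmooths (scale_vecs d L) (log_sum_exp S) v -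
           (log_sum_exp S v + d\<^sup>2 / 2 * (\<Sum>a\<leftarrow>L. wvar S (softmax S v) a))\<bar> \<le> C * d ^ 3"
proof (induction L)
  case Nil
  show ?case by (auto intro!: exI[of _ 0])
next
  case (Cons b L)
  let ?F = "log_sum_exp S"
  note lipF = lip_log_sum_exp[OF S]
  define W where "W v = (\<Sum>a\<leftarrow>L. wvar S (softmax S v) a)" for v
  have "\<exists>c. lip_l1 c S W"
    unfolding W_def
  proof (induction L)
    case Nil
    show ?case by (auto intro: lip_l1_const)
  next
    case (Cons a L)
    then show ?case using lip_wvar_softmax[OF S(1), of a] by (auto intro: lip_l1_add)
  qed
  then obtain c where c: "lip_l1 c S W" by blast
  obtain C where C: "C \<ge> 0" "\<And>d v. d \<in> {0..1} \<Longrightarrow> \<bar>gsmooths (scale_vecs d L) ?F v -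
           (?F v + d\<^sup>2 / 2 * W v)\<bar> \<le> C * d ^ 3"
    using Cons.IH unfolding W_def by blast
  obtain D where D: "D \<ge> 0" "\<And>d v. d \<ge> 0 \<Longrightarrow> \<bar>gsmooth (\<lambda>s. d * b s) ?F v -
           (?F v + d\<^sup>2 / 2 * wvar S (softmax S v) b)\<bar> \<le> D * d ^ 3"
    using gsmooth_log_sum_exp_expansion[OF S, of b] by blast
  define E where "E = (\<integral>z. \<bar>z\<bar> \<partial>std_normal_distribution) * (c * (\<Sum>s\<in>S. \<bar>b s\<bar>))"
  have E: "0 \<le> E"
    using lip_l1_nonneg[OF c] unfolding E_def
    by (intro mult_nonneg_nonneg integral_nonneg sum_nonneg) auto
  show ?case
  proof (intro exI conjI ballI allI)
    show "0 \<le> C + D + E / 2" using C(1) D(1) E by simp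
    fix d :: real and v :: "'a \<Rightarrow> real" assume d: "d \<in> {0..1}"
    let ?g = "gsmooth (\<lambda>s. d * b s)"
    have 1: "\<bar>?g (gsmooths (scale_vecs d L) ?F) v - ?g (\<lambda>v. ?F v + d\<^sup>2 / 2 * W v) v\<bar> \<le> C * d ^ 3"
      by (rule gsmooth_abs_diff_le[OF lip_l1_gsmooths[OF lipF] lip_l1_add[OF lipF lip_l1_cmult[OF c]] C(2)[OF d]]) simp
    have 2: "?g (\<lambda>v. ?F v + d\<^sup>2 / 2 * W v) v = ?g ?F v + d\<^sup>2 / 2 * ?g W v"
      by (rule gsmooth_add_cmult[OF lipF c])
    have "\<bar>?g W v - W v\<bar> \<le> d * E"
      using gsmooth_close[OF c, of "\<lambda>s. d * b s" v] d
      by (simp add: E_def abs_mult sum_distrib_left[symmetric] mult_ac)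
    then have "d\<^sup>2 / 2 * \<bar>?g W v - W v\<bar> \<le> d\<^sup>2 / 2 * (d * E)"
      by (rule mult_left_mono) simp
    also have "d\<^sup>2 / 2 * (d * E) = E / 2 * d ^ 3"
      by (simp add: power3_eq_cube power2_eq_square)
    also have "d\<^sup>2 / 2 * \<bar>?g W v - W v\<bar> = \<bar>d\<^sup>2 / 2 * ?g W v - d\<^sup>2 / 2 * W v\<bar>"
      unfolding right_diff_distrib[symmetric] abs_mult by simp
    finally have 3: "\<bar>d\<^sup>2 / 2 * ?g W v - d\<^sup>2 / 2 * W v\<bar> \<le> E / 2 * d ^ 3" .
    show "\<bar>gsmooths (scale_vecs d (b # L)) ?F v - (?F v + d\<^sup>2 / 2 * (\<Sum>a\<leftarrow>b # L. wvar S (softmax S v) a))\<bar>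
        \<le> (C + D + E / 2) * d ^ 3"
    proof -
      have eqs: "gsmooths (scale_vecs d (b # L)) ?F v = ?g (gsmooths (scale_vecs d L) ?F) v"
        "(\<Sum>a\<leftarrow>b # L. wvar S (softmax S v) a) = wvar S (softmax S v) b + W v"
        by (simp_all add: W_def)
      have "\<bar>?g ?F v - (?F v + d\<^sup>2 / 2 * wvar S (softmax S v) b)\<bar> \<le> D * d ^ 3"
        using D(2) d by simp
      then show ?thesis
        using 1 2 3 unfolding eqs distrib_left distrib_right by linarith
    qed
  qed
qed

text \<open>The variances are compared for all probability weights because the one-step estimate
  must hold at every base point, with whatever softmax weights occur there.\<close>

theorem gsmooths_log_sum_exp_mono:
  assumes S: "finite S" "S \<noteq> {}"
    and var: "\<And>p. (\<And>s. s \<in> S \<Longrightarrow> 0 \<le> p s) \<Longrightarrow> (\<Sum>s\<in>S. p s) = 1 \<Longrightarrow>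
        (\<Sum>a\<leftarrow>L. wvar S p a) \<le> (\<Sum>b\<leftarrow>L'. wvar S p b)"
  shows "gsmooths L (log_sum_exp S) v \<le> gsmooths L' (log_sum_exp S) v"
proof -
  let ?F = "log_sum_exp S"
  note lipF = lip_log_sum_exp[OF S]
  obtain C where C: "\<And>d v. d \<in> {0..1} \<Longrightarrow> \<bar>gsmooths (scale_vecs d L) ?F v -
           (?F v + d\<^sup>2 / 2 * (\<Sum>a\<leftarrow>L. wvar S (softmax S v) a))\<bar> \<le> C * d ^ 3"
    using gsmooths_log_sum_exp_expansion[OF S, of L] by blast
  obtain D where D: "\<And>d v. d \<in> {0..1} \<Longrightarrow> \<bar>gsmooths (scale_vecs d L') ?F v -
           (?F v + d\<^sup>2 / 2 * (\<Sum>a\<leftarrow>L'. wvar S (softmax S v) a))\<bar> \<le> D * d ^ 3"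
    using gsmooths_log_sum_exp_expansion[OF S, of L'] by blast
  have step: "gsmooths (scale_vecs d L) ?F v \<le> gsmooths (scale_vecs d L') ?F v + (C + D) * d ^ 3"
    if d: "d \<in> {0..1}" for d v
  proof -
    have "d\<^sup>2 / 2 * (\<Sum>a\<leftarrow>L. wvar S (softmax S v) a) \<le> d\<^sup>2 / 2 * (\<Sum>a\<leftarrow>L'. wvar S (softmax S v) a)"
      by (intro mult_left_mono var softmax_nonneg softmax_sum S) auto
    then show ?thesis using C[OF d, of v] D[OF d, of v] unfolding distrib_right by linarith
  qed
  have "gsmooths L ?F v \<le> gsmooths L' ?F v + (C + D) / sqrt (real N)" if N: "N > 0" for N :: nat
  proof -
    \<comment> \<open>With this step size the \<open>N\<close> copies recombine to scale 1, while
      \<open>N\<close> errors \<open>(C + D) * d ^ 3\<close> add up to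
      \<open>(C + D) / sqrt (real N)\<close>.\<close>
    define d where "d = 1 / sqrt (real N)"
    have d: "d > 0" "d \<in> {0..1}" "sqrt (real N) * d = 1" using N by (auto simp: d_def)
    have "real N * ((C + D) * d ^ 3) = (C + D) / sqrt (real N)"
      using N by (simp add: d_def power3_eq_cube field_simps)
    then show ?thesis
      using gsmooths_replicate_le[OF lipF step[OF d(2)], of N v]
      unfolding gsmooths_replicate[OF lipF d(1) N] d(3) by simp
  qed
  moreover have "(\<lambda>N. gsmooths L' ?F v + (C + D) / sqrt (real N)) \<longlonglongrightarrow> gsmooths L' ?F v + 0"
    by (intro tendsto_intros tendsto_divide_0[OF tendsto_const]
        filterlim_at_top_imp_at_infinity filterlim_compose[OF sqrt_at_top] filterlim_real_sequentially)
  ultimately show ?thesis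
    by (intro LIMSEQ_le_const[of _ "gsmooths L' ?F v"]) (auto intro!: exI[of _ 1])
qed

section \<open>From smoothing operators to expectations over families of normal variables\<close>

lemma sets_PiM_std_normal: "sets (Pi\<^sub>M K (\<lambda>_. std_normal_distribution)) = sets (Pi\<^sub>M K (\<lambda>_. borel))"
  by (intro sets_PiM_cong) simp_all

text \<open>For a countable index type the Borel sets of the full function space form the product
  sigma-algebra, so continuity yields measurability.\<close>

lemma lip_l1_linear_measurable:
  fixes a :: "'k :: countable \<Rightarrow> 's \<Rightarrow> real"
  assumes "lip_l1 c S f"
  shows "(\<lambda>x. f (\<lambda>s. v s + (\<Sum>k\<in>K. x k * a k s))) \<in> borel_measurable (Pi\<^sub>M K (\<lambda>_. borel))"
proof -
  have "continuous_on UNIV (\<lambda>x. f (\<lambda>s. v s + (\<Sum>k\<in>K. x k * a k s)))"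
    by (rule lip_l1_compose_continuous[OF assms])
      (intro continuous_intros continuous_on_product_coordinates)
  then have "(\<lambda>x. f (\<lambda>s. v s + (\<Sum>k\<in>K. x k * a k s))) \<in> borel_measurable borel"
    by (rule borel_measurable_continuous_onI)
  then have G: "(\<lambda>x. f (\<lambda>s. v s + (\<Sum>k\<in>K. x k * a k s))) \<in> borel_measurable (Pi\<^sub>M UNIV (\<lambda>_. borel))"
    by (simp cong: measurable_cong_sets add: sets_PiM_equal_borel)
  \<comment> \<open>A point of the product over \<open>K\<close> is \<open>undefined\<close>
    elsewhere, so its inclusion into the full function space is constant in the coordinates outside
    \<open>K\<close>.\<close>
  have "(\<lambda>x. x) \<in> measurable (Pi\<^sub>M K (\<lambda>_. borel)) (Pi\<^sub>M UNIV (\<lambda>_. borel :: real measure))"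
  proof (rule measurable_PiM_single')
    fix k :: 'k
    show "(\<lambda>x. x k) \<in> borel_measurable (Pi\<^sub>M K (\<lambda>_. borel))"
    proof (cases "k \<in> K")
      case False
      then show ?thesis
        by (subst measurable_cong[where g = "\<lambda>_. undefined"])
          (auto simp: space_PiM PiE_def extensional_def)
    qed simp
  qed auto
  from measurable_compose[OF this G] show ?thesis .
qed

lemma lip_l1_linear_integrable:
  fixes a :: "'k :: countable \<Rightarrow> 's \<Rightarrow> real"
  assumes "lip_l1 c S f" "finite K"
  shows "integrable (Pi\<^sub>M K (\<lambda>_. std_normal_distribution)) (\<lambda>x. f (\<lambda>s. v s + (\<Sum>k\<in>K. x k * a k s)))"
    (is "integrable ?P _")
proof (rule Bochner_Integration.integrable_bound)
  interpret P: prob_space ?P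
    by (intro prob_space_PiM std_normal.prob_space_axioms)
  have "integrable ?P (\<lambda>x. \<bar>x k\<bar>)" if "k \<in> K" for k
  proof -
    have "distr ?P std_normal_distribution (\<lambda>x. x k) = std_normal_distribution"
      using that by (intro distr_PiM_component std_normal.prob_space_axioms)
    then have "integrable (distr ?P std_normal_distribution (\<lambda>x. x k)) (\<lambda>z. \<bar>z\<bar>)" by simp
    then show ?thesis
      by (rule integrable_distr[rotated]) (use that in simp)
  qed
  then show "integrable ?P (\<lambda>x. \<bar>f v\<bar> + c * (\<Sum>s\<in>S. \<Sum>k\<in>K. \<bar>x k\<bar> * \<bar>a k s\<bar>))"
    by (intro Bochner_Integration.integrable_add integrable_mult_right
        Bochner_Integration.integrable_sum integrable_mult_left) auto
  show "(\<lambda>x. f (\<lambda>s. v s + (\<Sum>k\<in>K. x k * a k s))) \<in> borel_measurable ?P"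
    using lip_l1_linear_measurable[OF assms(1), where v = v and K = K and a = a]
    by (simp cong: measurable_cong_sets add: sets_PiM_std_normal)
  show "AE x in ?P. norm (f (\<lambda>s. v s + (\<Sum>k\<in>K. x k * a k s)))
      \<le> norm (\<bar>f v\<bar> + c * (\<Sum>s\<in>S. \<Sum>k\<in>K. \<bar>x k\<bar> * \<bar>a k s\<bar>))"
  proof (rule AE_I2)
    fix x
    have "c * (\<Sum>s\<in>S. \<bar>\<Sum>k\<in>K. x k * a k s\<bar>) \<le> c * (\<Sum>s\<in>S. \<Sum>k\<in>K. \<bar>x k\<bar> * \<bar>a k s\<bar>)"
      using lip_l1_nonneg[OF assms(1)] unfolding abs_mult[symmetric]
      by (intro mult_left_mono sum_mono sum_abs)
    then show "norm (f (\<lambda>s. v s + (\<Sum>k\<in>K. x k * a k s)))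
        \<le> norm (\<bar>f v\<bar> + c * (\<Sum>s\<in>S. \<Sum>k\<in>K. \<bar>x k\<bar> * \<bar>a k s\<bar>))"
      using lip_l1_bound[OF assms(1), of v "\<lambda>s. \<Sum>k\<in>K. x k * a k s"] by simp
  qed
qed

text \<open>Integrating out one coordinate is one smoothing. The coordinate split off at the head of
  the list becomes the innermost operator, so the induction must generalise \<open>f\<close>, and
  commutation restores the order of the list.\<close>

lemma integral_PiM_gsmooths:
  fixes a :: "'k :: countable \<Rightarrow> 's \<Rightarrow> real"
  assumes "lip_l1 c S f" "distinct ks"
  shows "(\<integral>x. f (\<lambda>s. v s + (\<Sum>k\<in>set ks. x k * a k s)) \<partial>Pi\<^sub>M (set ks) (\<lambda>_. std_normal_distribution)) =
    gsmooths (map a ks) f v"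
  using assms
proof (induction ks arbitrary: f)
  case Nil
  show ?case by (simp add: PiM_empty lebesgue_integral_count_space_finite)
next
  case (Cons k ks)
  interpret product_sigma_finite "\<lambda>_::'k. std_normal_distribution"
    by (simp add: product_sigma_finite_def std_normal.sigma_finite_measure_axioms)
  let ?K = "set ks"
  have k: "k \<notin> ?K" using Cons.prems(2) by simp
  have sum: "(\<Sum>j\<in>insert k ?K. (x(k := y)) j * a j s) = (\<Sum>j\<in>?K. x j * a j s) + y * a k s" for x y s
  proof -
    have "(\<Sum>j\<in>?K. (x(k := y)) j * a j s) = (\<Sum>j\<in>?K. x j * a j s)"
      using k by (intro sum.cong) auto
    then show ?thesis using k by simp
  qed
  have "(\<integral>x. f (\<lambda>s. v s + (\<Sum>j\<in>set (k # ks). x j * a j s)) \<partial>Pi\<^sub>M (set (k # ks)) (\<lambda>_. std_normal_distribution)) =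
     (\<integral>x. (\<integral>y. f (\<lambda>s. v s + (\<Sum>j\<in>insert k ?K. (x(k := y)) j * a j s)) \<partial>std_normal_distribution)
        \<partial>Pi\<^sub>M ?K (\<lambda>_. std_normal_distribution))"
    unfolding list.set
    by (rule product_integral_insert[OF finite_set k lip_l1_linear_integrable[OF Cons.prems(1)]]) simp
  also have "\<dots> = (\<integral>x. gsmooth (a k) f (\<lambda>s. v s + (\<Sum>j\<in>?K. x j * a j s))
        \<partial>Pi\<^sub>M ?K (\<lambda>_. std_normal_distribution))"
    by (simp only: sum gsmooth_def add.assoc)
  also have "\<dots> = gsmooths (map a ks) (gsmooth (a k) f) v"
    using Cons.prems by (intro Cons.IH lip_l1_gsmooth) auto
  also have "\<dots> = gsmooths (map a (k # ks)) f v"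
    using gsmooth_gsmooths[OF Cons.prems(1)] by simp
  finally show ?case .
qed

context prob_space
begin

text \<open>Independence and standard normal marginals identify the joint law with the product
  measure. The comparison sees the random variables only through this lemma.\<close>

lemma expectation_std_normal_gsmooths:
  fixes a :: "'k :: countable \<Rightarrow> 's \<Rightarrow> real"
  assumes f: "lip_l1 c S f" and ks: "distinct ks" "ks \<noteq> []"
    and Z: "indep_vars (\<lambda>_. borel) Z (set ks)"
    and D: "\<And>k. k \<in> set ks \<Longrightarrow> distributed M lborel (Z k) std_normal_density"
  shows "expectation (\<lambda>w. f (\<lambda>s. \<Sum>k\<in>set ks. Z k w * a k s)) = gsmooths (map a ks) f (\<lambda>_. 0)"
    and "integrable M (\<lambda>w. f (\<lambda>s. \<Sum>k\<in>set ks. Z k w * a k s))"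
proof -
  let ?K = "set ks"
  let ?G = "\<lambda>x. f (\<lambda>s. 0 + (\<Sum>k\<in>?K. x k * a k s))"
  let ?h = "\<lambda>w. \<lambda>k\<in>?K. Z k w"
  have rv: "Z k \<in> borel_measurable M" if "k \<in> ?K" for k
    using distributed_measurable[OF D[OF that]] by simp
  have distr_Z: "distr M borel (Z k) = std_normal_distribution" if "k \<in> ?K" for k
  proof -
    have "distr M borel (Z k) = distr M lborel (Z k)" by (rule distr_cong) auto
    then show ?thesis using distributed_distr_eq_density[OF D[OF that]] by simp
  qed
  \<comment> \<open>The characterisation of independence by a product law asks for a nonempty index
    set, hence \<open>ks\<close> nonempty.\<close>
  have "distr M (Pi\<^sub>M ?K (\<lambda>_. borel)) ?h = Pi\<^sub>M ?K (\<lambda>k. distr M borel (Z k))"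
    using indep_vars_iff_distr_eq_PiM'[of ?K Z "\<lambda>_. borel"] ks(2) rv Z by auto
  also have "\<dots> = Pi\<^sub>M ?K (\<lambda>_. std_normal_distribution)"
    using distr_Z by (intro PiM_cong) auto
  finally have law: "distr M (Pi\<^sub>M ?K (\<lambda>_. borel)) ?h = Pi\<^sub>M ?K (\<lambda>_. std_normal_distribution)" .
  have h [measurable]: "?h \<in> measurable M (Pi\<^sub>M ?K (\<lambda>_. borel))"
    using rv by (intro measurable_restrict) auto
  note G = lip_l1_linear_measurable[OF f, where v = "\<lambda>_. 0" and K = ?K and a = a]
  have eq: "?G (?h w) = f (\<lambda>s. \<Sum>k\<in>?K. Z k w * a k s)" for w
    by (auto intro!: arg_cong[of _ _ f] sum.cong)
  show "expectation (\<lambda>w. f (\<lambda>s. \<Sum>k\<in>?K. Z k w * a k s)) = gsmooths (map a ks) f (\<lambda>_. 0)"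
    using integral_distr[OF h G] integral_PiM_gsmooths[OF f ks(1), of "\<lambda>_. 0" a]
    unfolding law eq by simp
  show "integrable M (\<lambda>w. f (\<lambda>s. \<Sum>k\<in>?K. Z k w * a k s))"
    using integrable_distr[OF h, of ?G] lip_l1_linear_integrable[OF f finite_set[of ks], where v = "\<lambda>_. 0" and a = a]
    unfolding law eq by simp
qed

end

section \<open>The maximum against log-sum-exp, and the comparison theorem\<close>

lemma lip_Max:
  assumes "finite S" "S \<noteq> {}"
  shows "lip_l1 1 S (\<lambda>v. Max (v ` S))"
proof (rule lip_l1I)
  fix v w :: "'a \<Rightarrow> real"
  have "Max (v ` S) \<le> Max (w ` S) + (\<Sum>s\<in>S. \<bar>v s - w s\<bar>)"
  proof (rule Max.boundedI)
    fix x assume "x \<in> v ` S"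
    then obtain s where s: "s \<in> S" "x = v s" by auto
    then have "w s \<le> Max (w ` S)" "\<bar>v s - w s\<bar> \<le> (\<Sum>s\<in>S. \<bar>v s - w s\<bar>)"
      using Max_ge[of "w ` S" "w s"] member_le_sum[of s S "\<lambda>s. \<bar>v s - w s\<bar>"] assms by auto
    with s show "x \<le> Max (w ` S) + (\<Sum>s\<in>S. \<bar>v s - w s\<bar>)" by linarith
  qed (use assms in auto)
  then show "Max (v ` S) - Max (w ` S) \<le> 1 * (\<Sum>s\<in>S. \<bar>v s - w s\<bar>)" by simp
qed simp

text \<open>With \<open>log_sum_exp_le_Max\<close> this encloses log-sum-exp in a window above the
  maximum whose width \<open>ln (card S)\<close> does not depend on \<open>v\<close>, hence is
  negligible once the vectors are scaled up.\<close>

lemma Max_le_log_sum_exp: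
  assumes S: "finite S" "S \<noteq> {}"
  shows "Max (v ` S) \<le> log_sum_exp S v"
proof (rule Max.boundedI)
  fix x assume "x \<in> v ` S"
  then obtain s where s: "s \<in> S" "x = v s" by auto
  then have "exp x \<le> (\<Sum>s\<in>S. exp (v s))"
    using member_le_sum[of s S "\<lambda>s. exp (v s)"] S by auto
  then have "ln (exp x) \<le> ln (\<Sum>s\<in>S. exp (v s))"
    by (subst ln_le_cancel_iff) (use sum_exp_pos[OF S] in auto)
  then show "x \<le> log_sum_exp S v" by (simp add: log_sum_exp_def)
qed (use S in auto)

lemma log_sum_exp_le_Max:
  assumes S: "finite S" "S \<noteq> {}"
  shows "log_sum_exp S v \<le> Max (v ` S) + ln (real (card S))"
proof -
  have "(\<Sum>s\<in>S. exp (v s)) \<le> real (card S) * exp (Max (v ` S))"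
    using S by (intro sum_bounded_above) auto
  then have "ln (\<Sum>s\<in>S. exp (v s)) \<le> ln (real (card S) * exp (Max (v ` S)))"
    by (subst ln_le_cancel_iff) (use sum_exp_pos[OF S] S in \<open>auto simp: card_gt_0_iff\<close>)
  also have "\<dots> = ln (real (card S)) + Max (v ` S)"
    using S by (simp add: ln_mult card_gt_0_iff)
  finally show ?thesis by (simp add: log_sum_exp_def)
qed

text \<open>Variance is half the mean squared difference of two independent draws with law
  \<open>p\<close>. This is where increments enter.\<close>

lemma wvar_eq_pairwise:
  assumes "(\<Sum>s\<in>S. p s) = 1"
  shows "wvar S p a = (\<Sum>s\<in>S. \<Sum>u\<in>S. p s * p u * (a s - a u)\<^sup>2) / 2"
proof -
  have "(\<Sum>s\<in>S. \<Sum>u\<in>S. p s * p u * (a s - a u)\<^sup>2) =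
      (\<Sum>s\<in>S. \<Sum>u\<in>S. p s * (a s)\<^sup>2 * p u + p s * (p u * (a u)\<^sup>2) - 2 * ((p s * a s) * (p u * a u)))"
    by (intro sum.cong refl) (simp add: power2_eq_square algebra_simps)
  also have "\<dots> = (\<Sum>s\<in>S. p s * (a s)\<^sup>2) * (\<Sum>u\<in>S. p u) + (\<Sum>s\<in>S. p s) * (\<Sum>u\<in>S. p u * (a u)\<^sup>2)
      - 2 * ((\<Sum>s\<in>S. p s * a s) * (\<Sum>u\<in>S. p u * a u))"
    unfolding sum.distrib sum_subtractf sum_product sum_distrib_left[of 2, symmetric] by simp
  finally show ?thesis
    unfolding assms by (simp add: wvar_def power2_eq_square)
qed

theorem (in prob_space) Sudakov_Fernique:
  fixes X :: "'k :: countable \<Rightarrow> 'a \<Rightarrow> real" and Y :: "'l :: countable \<Rightarrow> 'a \<Rightarrow> real"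
    and a :: "'k \<Rightarrow> 's \<Rightarrow> real" and b :: "'l \<Rightarrow> 's \<Rightarrow> real"
  assumes S: "finite S" "S \<noteq> {}" and K: "finite K" "K \<noteq> {}" and L: "finite L" "L \<noteq> {}"
    and X: "indep_vars (\<lambda>_. borel) X K" "\<And>k. k \<in> K \<Longrightarrow> distributed M lborel (X k) std_normal_density"
    and Y: "indep_vars (\<lambda>_. borel) Y L" "\<And>l. l \<in> L \<Longrightarrow> distributed M lborel (Y l) std_normal_density"
    and incr: "\<And>s u. s \<in> S \<Longrightarrow> u \<in> S \<Longrightarrow> (\<Sum>k\<in>K. (a k s - a k u)\<^sup>2) \<le> (\<Sum>l\<in>L. (b l s - b l u)\<^sup>2)"
  shows "expectation (\<lambda>w. Max ((\<lambda>s. \<Sum>k\<in>K. X k w * a k s) ` S)) \<le>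
    expectation (\<lambda>w. Max ((\<lambda>s. \<Sum>l\<in>L. Y l w * b l s) ` S))"
proof -
  obtain ks where ks: "set ks = K" "distinct ks" using finite_distinct_list[OF K(1)] by blast
  obtain ls where ls: "set ls = L" "distinct ls" using finite_distinct_list[OF L(1)] by blast
  have ne: "ks \<noteq> []" "ls \<noteq> []" using ks ls K L by auto
  let ?M = "\<lambda>v. Max (v ` S)" and ?F = "log_sum_exp S"
  note lipM = lip_Max[OF S] and lipF = lip_log_sum_exp[OF S]
  let ?ta = "\<lambda>t k s. t * a k s" and ?tb = "\<lambda>t l s. t * b l s"
  have scale: "?M (\<lambda>s. \<Sum>k\<in>K'. Z k * (t * c k s)) = t * ?M (\<lambda>s. \<Sum>k\<in>K'. Z k * c k s)"
    if "t > 0" for t and Z :: "'i \<Rightarrow> real" and c :: "'i \<Rightarrow> 's \<Rightarrow> real" and K'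
  proof -
    have "t * ?M (\<lambda>s. \<Sum>k\<in>K'. Z k * c k s) = Max ((\<lambda>x. t * x) ` (\<lambda>s. \<Sum>k\<in>K'. Z k * c k s) ` S)"
      using that S by (intro mono_Max_commute) (auto intro!: monoI)
    also have "(\<lambda>x. t * x) ` (\<lambda>s. \<Sum>k\<in>K'. Z k * c k s) ` S = (\<lambda>s. \<Sum>k\<in>K'. Z k * (t * c k s)) ` S"
      by (simp add: image_image sum_distrib_left mult_ac)
    finally show ?thesis by simp
  qed
  \<comment> \<open>The factor \<open>t\<close> acts as an inverse temperature: it multiplies both
    expected maxima but not the error \<open>ln (card S)\<close>.\<close>
  have main: "t * expectation (\<lambda>w. ?M (\<lambda>s. \<Sum>k\<in>K. X k w * a k s)) \<le>
      t * expectation (\<lambda>w. ?M (\<lambda>s. \<Sum>l\<in>L. Y l w * b l s)) + ln (real (card S))" if t: "t > 0" for t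
  proof -
    have "t * expectation (\<lambda>w. ?M (\<lambda>s. \<Sum>k\<in>K. X k w * a k s)) = gsmooths (map (?ta t) ks) ?M (\<lambda>_. 0)"
      using expectation_std_normal_gsmooths(1)[OF lipM ks(2) ne(1), of X "?ta t"] X
      by (simp add: ks(1) scale[OF t])
    also have "\<dots> \<le> gsmooths (map (?ta t) ks) ?F (\<lambda>_. 0)"
      by (rule gsmooths_mono[OF lipM lipF Max_le_log_sum_exp[OF S]])
    also have "\<dots> \<le> gsmooths (map (?tb t) ls) ?F (\<lambda>_. 0)"
    proof (rule gsmooths_log_sum_exp_mono[OF S])
      fix p :: "'s \<Rightarrow> real" assume p: "\<And>s. s \<in> S \<Longrightarrow> 0 \<le> p s" "(\<Sum>s\<in>S. p s) = 1"
      \<comment> \<open>Summed over the sources, the variances depend on the coefficients only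
        through total squared increments, with nonnegative weights \<open>p s * p u\<close>; so
        \<open>incr\<close> applies pair by pair.\<close>
      have swap: "(\<Sum>k\<in>K'. wvar S p (\<lambda>s. t * c k s)) =
          t\<^sup>2 * ((\<Sum>s\<in>S. \<Sum>u\<in>S. p s * p u * (\<Sum>k\<in>K'. (c k s - c k u)\<^sup>2)) / 2)"
        for c :: "'i \<Rightarrow> 's \<Rightarrow> real" and K'
      proof -
        have "(\<Sum>k\<in>K'. \<Sum>s\<in>S. \<Sum>u\<in>S. p s * p u * (c k s - c k u)\<^sup>2) =
            (\<Sum>s\<in>S. \<Sum>u\<in>S. p s * p u * (\<Sum>k\<in>K'. (c k s - c k u)\<^sup>2))"
          by (subst sum.swap, intro sum.cong refl, subst sum.swap) (simp add: sum_distrib_left)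
        then show ?thesis
          unfolding wvar_scale wvar_eq_pairwise[OF p(2)]
          by (simp flip: sum_distrib_left sum_divide_distrib)
      qed
      have "(\<Sum>k\<in>K. wvar S p (?ta t k)) \<le> (\<Sum>l\<in>L. wvar S p (?tb t l))"
        unfolding swap
        by (intro mult_left_mono divide_right_mono sum_mono incr mult_nonneg_nonneg p) auto
      then show "(\<Sum>c\<leftarrow>map (?ta t) ks. wvar S p c) \<le> (\<Sum>c\<leftarrow>map (?tb t) ls. wvar S p c)"
        by (simp add: comp_def sum_list_distinct_conv_sum_set ks ls)
    qed
    also have "\<dots> \<le> gsmooths (map (?tb t) ls) (\<lambda>v. ?M v + ln (real (card S))) (\<lambda>_. 0)"
      by (rule gsmooths_mono[OF lipF lip_l1_add[OF lipM lip_l1_const] log_sum_exp_le_Max[OF S]])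
    also have "\<dots> = gsmooths (map (?tb t) ls) ?M (\<lambda>_. 0) + ln (real (card S))"
      by (rule gsmooths_add_const[OF lipM])
    also have "gsmooths (map (?tb t) ls) ?M (\<lambda>_. 0) = t * expectation (\<lambda>w. ?M (\<lambda>s. \<Sum>l\<in>L. Y l w * b l s))"
      using expectation_std_normal_gsmooths(1)[OF lipM ls(2) ne(2), of Y "?tb t"] Y
      by (simp add: ls(1) scale[OF t])
    finally show ?thesis .
  qed
  have c: "ln (real (card S)) \<ge> 0" using S by (simp add: Suc_leI card_gt_0_iff)
  show ?thesis
  proof (rule field_le_epsilon)
    fix e :: real assume e: "e > 0"
    \<comment> \<open>The added 1 keeps \<open>t\<close> positive when \<open>S\<close> is a
      singleton and the logarithm is 0.\<close>
    define t where "t = (ln (real (card S)) + 1) / e"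
    have t: "t > 0" "ln (real (card S)) \<le> t * e" using e c by (auto simp: t_def)
    from main[OF t(1)] t(2) have "t * expectation (\<lambda>w. ?M (\<lambda>s. \<Sum>k\<in>K. X k w * a k s)) \<le>
      t * (expectation (\<lambda>w. ?M (\<lambda>s. \<Sum>l\<in>L. Y l w * b l s)) + e)"
      unfolding distrib_left by linarith
    then show "expectation (\<lambda>w. ?M (\<lambda>s. \<Sum>k\<in>K. X k w * a k s)) \<le>
      expectation (\<lambda>w. ?M (\<lambda>s. \<Sum>l\<in>L. Y l w * b l s)) + e"
      using t(1) by simp
  qed
qed

section \<open>Submatrix sums and decoupled sums\<close>

definition ksubsets :: "nat \<Rightarrow> nat \<Rightarrow> nat set set" where
  "ksubsets d k = {I. I \<subseteq> {1..d} \<and> card I = k}"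

text \<open>The sum of the \<open>k\<close> largest coordinates, written over index sets to avoid
  sorting and ties and to bring it under \<open>lip_Max\<close>.\<close>

definition top_sum :: "nat \<Rightarrow> nat \<Rightarrow> (nat \<Rightarrow> real) \<Rightarrow> real" where
  "top_sum d k x = Max ((\<lambda>I. \<Sum>i\<in>I. x i) ` ksubsets d k)"

lemma finite_ksubsets [simp]: "finite (ksubsets d k)"
  by (rule finite_subset[of _ "Pow {1..d}"]) (auto simp: ksubsets_def)

lemma ksubsets_nonempty: "k \<le> d \<Longrightarrow> ksubsets d k \<noteq> {}"
  using obtain_subset_with_card_n[of k "{1..d}"] by (auto simp: ksubsets_def)

lemma sum_if_subset:
  assumes "finite X" "W \<subseteq> X"
  shows "(\<Sum>x\<in>X. if x \<in> W then f x else 0) = (\<Sum>x\<in>W. f x :: real)"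
  using assms by (simp add: sum.inter_restrict[symmetric] Int_absorb1)

lemma Max_add_Times:
  fixes f :: "'a \<Rightarrow> real" and g :: "'b \<Rightarrow> real"
  assumes "finite X" "X \<noteq> {}" "finite Y" "Y \<noteq> {}"
  shows "Max ((\<lambda>(x, y). f x + g y) ` (X \<times> Y)) = Max (f ` X) + Max (g ` Y)"
proof (rule Max_eqI)
  show "finite ((\<lambda>(x, y). f x + g y) ` (X \<times> Y))" using assms by simp
  show "z \<le> Max (f ` X) + Max (g ` Y)" if "z \<in> (\<lambda>(x, y). f x + g y) ` (X \<times> Y)" for z
    using that assms by (auto intro!: add_mono)
  obtain x y where "x \<in> X" "f x = Max (f ` X)" "y \<in> Y" "g y = Max (g ` Y)"
    using Max_in[of "f ` X"] Max_in[of "g ` Y"] assms by (metis (no_types, lifting) finite_imageI imageE image_is_empty)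
  then show "Max (f ` X) + Max (g ` Y) \<in> (\<lambda>(x, y). f x + g y) ` (X \<times> Y)"
    by (metis (no_types, lifting) SigmaI case_prod_conv imageI)
qed

lemma Max_cmult_image:
  fixes f :: "'a \<Rightarrow> real"
  assumes "finite X" "X \<noteq> {}" "0 \<le> c"
  shows "Max ((\<lambda>x. c * f x) ` X) = c * Max (f ` X)"
proof -
  have "c * Max (f ` X) = Max ((\<lambda>x. c * x) ` f ` X)"
    using assms by (intro mono_Max_commute) (auto intro!: monoI mult_left_mono)
  then show ?thesis by (simp add: image_image)
qed

text \<open>A vector of \<open>flat_vectors d k\<close> is determined by its support. A support of
  size s gives coordinate sum \<open>s / sqrt k\<close>, and the prescribed value
  \<open>sqrt k\<close> forces s = k.\<close>

lemma flat_vectors_eq: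
  assumes "0 < k"
  shows "flat_vectors d k = (\<lambda>I. \<lambda>i\<in>{1..d}. if i \<in> I then 1 / sqrt (real k) else 0) ` ksubsets d k"
    (is "_ = ?v ` _")
proof (intro equalityI subsetI)
  have k: "sqrt (real k) > 0" "real k / sqrt (real k) = sqrt (real k)"
    using assms by (simp_all add: real_div_sqrt)
  have sum: "(\<Sum>i=1..d. if i \<in> I then 1 / sqrt (real k) else 0) = real (card I) / sqrt (real k)"
    if "I \<subseteq> {1..d}" for I
    using that by (simp add: sum_if_subset)
  {
    fix x assume x: "x \<in> flat_vectors d k"
    define I where "I = {i \<in> {1..d}. x i \<noteq> 0}"
    have x01: "x i = 0 \<or> x i = 1 / sqrt (real k)" if "i \<in> {1..d}" for i
      using x that by (auto simp: flat_vectors_def PiE_def Pi_def)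
    \<comment> \<open>Off \<open>{1..d}\<close> both functions are \<open>undefined\<close>, so
      agreement on \<open>{1..d}\<close> makes them equal.\<close>
    have "x \<in> extensional {1..d}" using x by (auto simp: flat_vectors_def PiE_def)
    then have xeq: "x = ?v I"
      using x01 by (auto simp: I_def extensional_def fun_eq_iff)
    have "sqrt (real k) = (\<Sum>i=1..d. x i)" using x by (simp add: flat_vectors_def)
    also have "\<dots> = (\<Sum>i=1..d. if i \<in> I then 1 / sqrt (real k) else 0)"
      using xeq by (intro sum.cong) (auto simp: fun_eq_iff)
    also have "\<dots> = real (card I) / sqrt (real k)" by (rule sum) (auto simp: I_def)
    finally have "real (card I) = real k" using k by (simp add: field_simps)
    then have "card I = k" by simp
    moreover have "I \<subseteq> {1..d}" unfolding I_def by blast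
    ultimately have "I \<in> ksubsets d k" by (simp add: ksubsets_def)
    then show "x \<in> ?v ` ksubsets d k"
      by (subst xeq) (rule imageI)
  }
  fix x assume "x \<in> ?v ` ksubsets d k"
  then obtain I where I: "I \<subseteq> {1..d}" "card I = k" and x: "x = ?v I"
    by (auto simp: ksubsets_def)
  show "x \<in> flat_vectors d k"
    using sum[OF I(1)] I(2) k(2) by (auto simp: flat_vectors_def x)
qed

lemma sum_flat_vector:
  fixes h :: "nat \<Rightarrow> real"
  assumes "I \<subseteq> {1..d}"
  shows "(\<Sum>i=1..d. h i * (\<lambda>i\<in>{1..d}. if i \<in> I then c else 0) i) = c * (\<Sum>i\<in>I. h i :: real)"
proof -
  have "(\<Sum>i=1..d. h i * (\<lambda>i\<in>{1..d}. if i \<in> I then c else 0) i) = (\<Sum>i=1..d. if i \<in> I then c * h i else 0)"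
    by (intro sum.cong) auto
  also have "\<dots> = (\<Sum>i\<in>I. c * h i)"
    using assms by (intro sum_if_subset) auto
  finally show ?thesis by (simp add: sum_distrib_left)
qed

lemma setcompr2_image:
  "{F y x | x y. x \<in> w ` K2 \<and> y \<in> v ` K1} = (\<lambda>(I, J). F (v I) (w J)) ` (K1 \<times> K2)"
  by force

lemma setcompr2_Times:
  "{F x y | x y. P x \<and> P' x \<and> Q y \<and> Q' y} = (\<lambda>(x, y). F x y) ` ({x. P x \<and> P' x} \<times> {y. Q y \<and> Q' y})"
  by force

text \<open>The objective is a term in \<open>y\<close> plus a term in \<open>x\<close> over a
  product of feasible sets, so the two maximisations separate.\<close>

lemma decoupled_max_eq_top_sum:
  assumes "0 < k1" "k1 \<le> m" "0 < k2" "k2 \<le> n"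
  shows "decoupled_max m n k1 k2 h g = 1 / sqrt (real k1 * real k2) *
    (top_sum m k1 h / sqrt (real k1) + top_sum n k2 g / sqrt (real k2))"
proof -
  let ?f = "\<lambda>I. 1 / sqrt (real k1) * (\<Sum>i\<in>I. h i)" and ?g = "\<lambda>J. 1 / sqrt (real k2) * (\<Sum>j\<in>J. g j)"
  let ?v = "\<lambda>d k I. \<lambda>i\<in>{1..d}. if i \<in> I then 1 / sqrt (real k) else 0"
  have "{(\<Sum>i=1..m. h i * y i) + (\<Sum>j=1..n. g j * x j) | x y.
            x \<in> flat_vectors n k2 \<and> y \<in> flat_vectors m k1} =
        (\<lambda>(I, J). (\<Sum>i=1..m. h i * ?v m k1 I i) + (\<Sum>j=1..n. g j * ?v n k2 J j)) `
          (ksubsets m k1 \<times> ksubsets n k2)"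
    unfolding flat_vectors_eq[OF assms(1)] flat_vectors_eq[OF assms(3)] by (rule setcompr2_image)
  also have "\<dots> = (\<lambda>(I, J). ?f I + ?g J) ` (ksubsets m k1 \<times> ksubsets n k2)"
    by (rule image_cong[OF refl])
      (simp only: split_paired_all mem_Sigma_iff ksubsets_def mem_Collect_eq case_prod_conv sum_flat_vector)
  finally have eq: "{(\<Sum>i=1..m. h i * y i) + (\<Sum>j=1..n. g j * x j) | x y.
            x \<in> flat_vectors n k2 \<and> y \<in> flat_vectors m k1} =
        (\<lambda>(I, J). ?f I + ?g J) ` (ksubsets m k1 \<times> ksubsets n k2)" .
  note ne = ksubsets_nonempty[OF assms(2)] ksubsets_nonempty[OF assms(4)]
  have "Max (?f ` ksubsets m k1) = 1 / sqrt (real k1) * top_sum m k1 h"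
    "Max (?g ` ksubsets n k2) = 1 / sqrt (real k2) * top_sum n k2 g"
    unfolding top_sum_def by (intro Max_cmult_image finite_ksubsets ne; simp)+
  then show ?thesis
    unfolding decoupled_max_def eq Max_add_Times[OF finite_ksubsets ne(1) finite_ksubsets ne(2)] by simp
qed

section \<open>Increments of the submatrix sums and of the decoupled sums\<close>

lemma sum_of_bool_diff_square:
  assumes "finite X" "U \<subseteq> X" "V \<subseteq> X"
  shows "(\<Sum>x\<in>X. (of_bool (x \<in> U) - of_bool (x \<in> V) :: real)\<^sup>2) =
    real (card U) + real (card V) - 2 * real (card (U \<inter> V))"
proof -
  have "(\<Sum>x\<in>X. (of_bool (x \<in> U) - of_bool (x \<in> V) :: real)\<^sup>2) =
      (\<Sum>x\<in>X. of_bool (x \<in> U) + of_bool (x \<in> V) - 2 * of_bool (x \<in> U \<inter> V))"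
    by (intro sum.cong) (auto simp: of_bool_def)
  also have "\<dots> = real (card U) + real (card V) - 2 * real (card (U \<inter> V))"
  proof -
    have "(\<Sum>x\<in>X. of_bool (x \<in> W) :: real) = real (card W)" if "W \<subseteq> X" for W
      using that assms(1) by (simp add: Int_absorb1)
    from this[of U] this[of V] this[of "U \<inter> V"] assms show ?thesis
      unfolding sum.distrib sum_subtractf sum_distrib_left[symmetric] by (metis le_infI1)
  qed
  finally show ?thesis .
qed

text \<open>Writing \<open>p = card (I \<inter> I')\<close> and \<open>q = card (J \<inter> J')\<close>, the difference of the two sides
  is \<open>2 (k1 - p) (k2 - q)\<close>.\<close>
lemma submatrix_increment_le:
  assumes "I \<in> ksubsets m k1" "I' \<in> ksubsets m k1" "J \<in> ksubsets n k2" "J' \<in> ksubsets n k2"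
  shows "(\<Sum>x\<in>{1..m}\<times>{1..n}. (of_bool (x \<in> I \<times> J) - of_bool (x \<in> I' \<times> J') :: real)\<^sup>2) \<le>
    real k2 * (\<Sum>i\<in>{1..m}. (of_bool (i \<in> I) - of_bool (i \<in> I'))\<^sup>2) +
    real k1 * (\<Sum>j\<in>{1..n}. (of_bool (j \<in> J) - of_bool (j \<in> J'))\<^sup>2)"
proof -
  have sub: "I \<subseteq> {1..m}" "I' \<subseteq> {1..m}" "J \<subseteq> {1..n}" "J' \<subseteq> {1..n}"
    and card: "card I = k1" "card I' = k1" "card J = k2" "card J' = k2"
    using assms by (auto simp: ksubsets_def)
  define p q where "p = real (card (I \<inter> I'))" and "q = real (card (J \<inter> J'))"
  have "p \<le> real k1" "q \<le> real k2"
    unfolding p_def q_def card(1,3)[symmetric]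
    using sub by (auto intro!: card_mono intro: finite_subset)
  then have "0 \<le> (real k1 - p) * (real k2 - q)" by simp
  moreover have "I \<times> J \<inter> I' \<times> J' = (I \<inter> I') \<times> (J \<inter> J')" by auto
  ultimately show ?thesis
    using sub by (subst (1 2 3) sum_of_bool_diff_square)
      (auto simp: card card_cartesian_product p_def q_def algebra_simps)
qed

text \<open>Joint independence is given over a disjoint sum of index sets; an injection pulls it
  back to a single summand. Events are carried to the image by \<open>inv_into\<close>.\<close>

lemma (in prob_space) indep_sets_reindex:
  assumes f: "inj_on f I" and F: "indep_sets F (f ` I)"
  shows "indep_sets (\<lambda>i. F (f i)) I"
  unfolding indep_sets_def
proof (intro conjI ballI allI impI)
  show "F (f i) \<subseteq> events" if "i \<in> I" for i
    using F that by (auto simp: indep_sets_def)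
  fix J A assume J: "J \<subseteq> I" "J \<noteq> {}" "finite J" and A: "A \<in> Pi J (\<lambda>i. F (f i))"
  let ?B = "\<lambda>y. A (inv_into I f y)"
  have B: "?B (f j) = A j" if "j \<in> J" for j
    using f J(1) that by (simp add: inv_into_f_f subset_eq)
  have "prob (\<Inter>y\<in>f ` J. ?B y) = (\<Prod>y\<in>f ` J. prob (?B y))"
    using J A by (intro indep_setsD[OF F]) (auto simp: B)
  moreover have "(\<Prod>y\<in>f ` J. prob (?B y)) = (\<Prod>j\<in>J. prob (A j))"
    using inj_on_subset[OF f J(1)] by (simp add: prod.reindex B)
  moreover have "(\<Inter>y\<in>f ` J. ?B y) = (\<Inter>j\<in>J. A j)"
    using B by auto
  ultimately show "prob (\<Inter>j\<in>J. A j) = (\<Prod>j\<in>J. prob (A j))" by simp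
qed

lemma (in prob_space) indep_vars_reindex:
  assumes "inj_on f I" "indep_vars N X (f ` I)"
  shows "indep_vars (\<lambda>i. N (f i)) (\<lambda>i. X (f i)) I"
  using assms(2) indep_sets_reindex[OF assms(1)] unfolding indep_vars_def by auto

text \<open>After multiplication by \<open>k1 * k2\<close> both quantities are maxima of Gaussian
  families over the same pairs of index sets, so \<open>Sudakov_Fernique\<close> applies with the
  increments of \<open>submatrix_increment_le\<close>.\<close>

lemma (in prob_space) expectation_max_avg_submatrix_le:
  fixes A :: "nat \<Rightarrow> nat \<Rightarrow> 'a \<Rightarrow> real" and h g :: "nat \<Rightarrow> 'a \<Rightarrow> real"
  assumes k: "0 < k1" "k1 \<le> m" "0 < k2" "k2 \<le> n"
    and A: "\<And>i j. i \<in> {1..m} \<Longrightarrow> j \<in> {1..n} \<Longrightarrow> distributed M lborel (A i j) std_normal_density"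
    and h: "\<And>i. i \<in> {1..m} \<Longrightarrow> distributed M lborel (h i) std_normal_density"
    and g: "\<And>j. j \<in> {1..n} \<Longrightarrow> distributed M lborel (g j) std_normal_density"
    and ind: "indep_vars (\<lambda>_. borel) (case_sum (\<lambda>(i, j). A i j) (case_sum h g))
                (({1..m} \<times> {1..n}) <+> ({1..m} <+> {1..n}))"
  shows "expectation (\<lambda>w. max_avg_submatrix m n k1 k2 (\<lambda>i j. A i j w)) \<le>
    expectation (\<lambda>w. decoupled_max m n k1 k2 (\<lambda>i. h i w) (\<lambda>j. g j w))"
proof -
  let ?S = "ksubsets m k1 \<times> ksubsets n k2"
  let ?K = "{1..m} \<times> {1..n}" and ?L = "{1..m} <+> {1..n}"
  let ?X = "\<lambda>(i, j). A i j" and ?Y = "case_sum h g"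
  define a :: "nat \<times> nat \<Rightarrow> nat set \<times> nat set \<Rightarrow> real"
    where "a x s = of_bool (x \<in> fst s \<times> snd s)" for x s
  \<comment> \<open>A selected row accounts for \<open>k2\<close> entries, so its variable gets
    variance \<open>k2\<close>, that is, coefficient \<open>sqrt k2\<close>; columns are
    symmetric.\<close>
  define b :: "nat + nat \<Rightarrow> nat set \<times> nat set \<Rightarrow> real"
    where "b x s = case_sum (\<lambda>i. sqrt (real k2) * of_bool (i \<in> fst s)) (\<lambda>j. sqrt (real k1) * of_bool (j \<in> snd s)) x"
    for x s
  have ne: "ksubsets m k1 \<noteq> {}" "ksubsets n k2 \<noteq> {}"
    using k by (simp_all add: ksubsets_nonempty)
  have sum_b: "(\<Sum>l\<in>?L. F l) = (\<Sum>i\<in>{1..m}. F (Inl i)) + (\<Sum>j\<in>{1..n}. F (Inr j))" for F :: "nat + nat \<Rightarrow> real"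
    by (simp add: sum.Plus comp_def)
  have indA: "indep_vars (\<lambda>_. borel) ?X ?K"
    using indep_vars_reindex[OF inj_Inl indep_vars_subset[OF ind, of "Inl ` ?K"]] by auto
  have indY: "indep_vars (\<lambda>_. borel) ?Y ?L"
    using indep_vars_reindex[OF inj_Inr indep_vars_subset[OF ind, of "Inr ` ?L"]] by auto
  have SF: "expectation (\<lambda>w. Max ((\<lambda>s. \<Sum>x\<in>?K. ?X x w * a x s) ` ?S)) \<le>
      expectation (\<lambda>w. Max ((\<lambda>s. \<Sum>l\<in>?L. ?Y l w * b l s) ` ?S))"
  proof (rule Sudakov_Fernique[OF _ _ _ _ _ _ indA _ indY])
    show "(\<Sum>x\<in>?K. (a x s - a x u)\<^sup>2) \<le> (\<Sum>l\<in>?L. (b l s - b l u)\<^sup>2)" if "s \<in> ?S" "u \<in> ?S" for s u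
    proof -
      have "(\<Sum>l\<in>?L. (b l s - b l u)\<^sup>2) =
        real k2 * (\<Sum>i\<in>{1..m}. (of_bool (i \<in> fst s) - of_bool (i \<in> fst u))\<^sup>2) +
        real k1 * (\<Sum>j\<in>{1..n}. (of_bool (j \<in> snd s) - of_bool (j \<in> snd u))\<^sup>2)"
        unfolding sum_b by (simp add: b_def power_mult_distrib sum_distrib_left flip: right_diff_distrib)
      then show ?thesis
        using submatrix_increment_le[of "fst s" m k1 "fst u" "snd s" n k2 "snd u"] that
        by (auto simp: a_def)
    qed
  qed (use k ne A h g in auto)
  have "max_avg_submatrix m n k1 k2 (\<lambda>i j. A i j w) =
      1 / (real k1 * real k2) * Max ((\<lambda>s. \<Sum>x\<in>?K. ?X x w * a x s) ` ?S)" for w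
  proof -
    have "(\<Sum>x\<in>?K. ?X x w * a x (I, J)) = (\<Sum>i\<in>I. \<Sum>j\<in>J. A i j w)"
      if "I \<subseteq> {1..m}" "J \<subseteq> {1..n}" for I J
    proof -
      have "(\<Sum>x\<in>?K. ?X x w * a x (I, J)) = (\<Sum>x\<in>?K. if x \<in> I \<times> J then ?X x w else 0)"
        by (intro sum.cong) (auto simp: a_def)
      also have "\<dots> = (\<Sum>x\<in>I \<times> J. ?X x w)"
        using that by (intro sum_if_subset) auto
      finally show ?thesis by (simp add: sum.cartesian_product case_prod_unfold)
    qed
    then have "(\<lambda>s. \<Sum>x\<in>?K. ?X x w * a x s) ` ?S = (\<lambda>(I, J). \<Sum>i\<in>I. \<Sum>j\<in>J. A i j w) ` ?S"
      by (intro image_cong refl) (auto simp only: ksubsets_def split: prod.split)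
    then show ?thesis
      unfolding max_avg_submatrix_def setcompr2_Times ksubsets_def by (simp only:)
  qed
  moreover have "decoupled_max m n k1 k2 (\<lambda>i. h i w) (\<lambda>j. g j w) =
      1 / (real k1 * real k2) * Max ((\<lambda>s. \<Sum>l\<in>?L. ?Y l w * b l s) ` ?S)" for w
  proof -
    have "(\<Sum>i=1..d. f i * (c * of_bool (i \<in> I))) = c * (\<Sum>i\<in>I. f i)" if "I \<in> ksubsets d k"
      for I d k c and f :: "nat \<Rightarrow> real"
    proof -
      have "(\<Sum>i=1..d. f i * (c * of_bool (i \<in> I))) = (\<Sum>i=1..d. if i \<in> I then c * f i else 0)"
        by (intro sum.cong) auto
      also have "\<dots> = (\<Sum>i\<in>I. c * f i)"
        using that by (intro sum_if_subset) (auto simp: ksubsets_def)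
      finally show ?thesis by (simp add: sum_distrib_left)
    qed
    then have "(\<lambda>s. \<Sum>l\<in>?L. ?Y l w * b l s) ` ?S =
       (\<lambda>(I, J). sqrt (real k2) * (\<Sum>i\<in>I. h i w) + sqrt (real k1) * (\<Sum>j\<in>J. g j w)) ` ?S"
      unfolding sum_b by (intro image_cong) (auto simp: b_def)
    then have "Max ((\<lambda>s. \<Sum>l\<in>?L. ?Y l w * b l s) ` ?S) =
       sqrt (real k2) * top_sum m k1 (\<lambda>i. h i w) + sqrt (real k1) * top_sum n k2 (\<lambda>j. g j w)"
      unfolding top_sum_def using ne by (simp add: Max_add_Times Max_cmult_image)
    \<comment> \<open>Division by \<open>k1 * k2\<close> turns the weights \<open>sqrt k2\<close>
      and \<open>sqrt k1\<close> into the normalisation of \<open>decoupled_max\<close>.\<close>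
    moreover have "1 / (real k1 * real k2) * (sqrt (real k2) * x + sqrt (real k1) * y) =
       1 / sqrt (real k1 * real k2) * (x / sqrt (real k1) + y / sqrt (real k2))" for x y
    proof -
      define r t where "r = sqrt (real k1)" and "t = sqrt (real k2)"
      have "r > 0" "t > 0" "real k1 = r * r" "real k2 = t * t" using k by (auto simp: r_def t_def)
      then show ?thesis by (simp add: real_sqrt_mult field_simps)
    qed
    ultimately show ?thesis
      unfolding decoupled_max_eq_top_sum[OF k] by simp
  qed
  ultimately show ?thesis
    using SF by (simp add: divide_right_mono)
qed

section \<open>The error function and normal tails\<close>

lemma erf_has_real_derivative:
  "(erf has_real_derivative 2 / sqrt pi * exp (- x\<^sup>2)) (at x)"
proof -
  \<comment> \<open>The interval has \<open>x\<close> in its interior, so the derivative within it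
    is the full derivative.\<close>
  let ?b = "\<bar>x\<bar> + 1"
  have "((\<lambda>u. LBINT t=ereal 0..ereal u. exp (- t\<^sup>2)) has_vector_derivative exp (- x\<^sup>2)) (at x within {- ?b..?b})"
    by (rule interval_integral_FTC2) (auto intro!: continuous_intros)
  moreover have "at x within {- ?b..?b} = at x"
    by (rule at_within_Icc_at) auto
  ultimately have "((\<lambda>u. LBINT t=0..ereal u. exp (- t\<^sup>2)) has_real_derivative exp (- x\<^sup>2)) (at x)"
    by (simp add: has_real_derivative_iff_has_vector_derivative zero_ereal_def)
  from DERIV_cmult[OF this, of "2 / sqrt pi"] show ?thesis
    unfolding erf_def[abs_def] by simp
qed

lemma erf_minus: "erf (- x) = - erf x"
proof -
  have "(LBINT t=0..ereal (- x). exp (- t\<^sup>2)) = (LBINT t=ereal x..0. exp (- t\<^sup>2))"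
    using interval_integral_reflect[of 0 "ereal (- x)" "\<lambda>t. exp (- t\<^sup>2)"] by simp
  also have "\<dots> = - (LBINT t=0..ereal x. exp (- t\<^sup>2))"
    by (rule interval_integral_endpoints_reverse)
  finally show ?thesis by (simp add: erf_def)
qed

lemma erf_tendsto_1: "(erf \<longlongrightarrow> 1) at_top"
proof -
  let ?f = "\<lambda>t::real. indicator {0..} t *\<^sub>R exp (- t\<^sup>2)"
  have "((\<lambda>y. \<integral>t. indicator {..y} t *\<^sub>R ?f t \<partial>lborel) \<longlongrightarrow> (\<integral>t. ?f t \<partial>lborel)) at_top"
    using gaussian_moment_0 by (intro tendsto_integral_at_top) (auto simp: has_bochner_integral_iff)
  also have "(\<integral>t. ?f t \<partial>lborel) = sqrt pi / 2"
    using gaussian_moment_0 by (rule has_bochner_integral_integral_eq)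
  finally have "((\<lambda>y. 2 / sqrt pi * (\<integral>t. indicator {..y} t *\<^sub>R ?f t \<partial>lborel)) \<longlongrightarrow>
      2 / sqrt pi * (sqrt pi / 2)) at_top"
    by (intro tendsto_intros)
  then have "((\<lambda>y. 2 / sqrt pi * (\<integral>t. indicator {..y} t *\<^sub>R ?f t \<partial>lborel)) \<longlongrightarrow> 1) at_top"
    by simp
  moreover have "\<forall>\<^sub>F y in at_top. 2 / sqrt pi * (\<integral>t. indicator {..y} t *\<^sub>R ?f t \<partial>lborel) = erf y"
    using eventually_ge_at_top[of "0::real"]
  proof eventually_elim
    case (elim y)
    have "(\<integral>t. indicator {..y} t *\<^sub>R ?f t \<partial>lborel) = (LBINT t:{0..y}. exp (- t\<^sup>2))"
      unfolding set_lebesgue_integral_def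
      by (intro Bochner_Integration.integral_cong) (auto split: split_indicator)
    then show ?case
      using elim interval_integral_Icc[of 0 y "\<lambda>t. exp (- t\<^sup>2)"]
      by (simp add: erf_def zero_ereal_def)
  qed
  ultimately show ?thesis by (rule Lim_transform_eventually)
qed

text \<open>As \<open>erfinv\<close> is \<open>inv erf\<close>, it suffices to find \<open>y\<close>
  in the range of \<open>erf\<close>. Limit 1 at infinity and oddness give arguments with values on
  both sides of \<open>y\<close>, and the intermediate value theorem applies between them.\<close>

lemma erf_erfinv:
  assumes "- 1 < y" "y < 1"
  shows "erf (erfinv y) = y"
proof -
  have "\<forall>\<^sub>F b in at_top. y < erf b" "\<forall>\<^sub>F a in at_top. - y < erf a"
    using order_tendstoD(1)[OF erf_tendsto_1] assms by auto
  then obtain a b where ab: "b \<ge> 0" "y < erf b" "a \<ge> 0" "- y < erf a"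
    by (metis (no_types, lifting) eventually_at_top_linorder linorder_linear)
  have "\<exists>x. - a \<le> x \<and> x \<le> b \<and> erf x = y"
    by (rule IVT) (use ab erf_minus[of a] DERIV_isCont[OF erf_has_real_derivative] in auto)
  then have "y \<in> range erf" by auto
  then show ?thesis unfolding erfinv_def by (rule f_inv_into_f)
qed

text \<open>The improper fundamental theorem on the ray above \<nu>. It serves \<open>f = 1\<close>,
  with an antiderivative built from \<open>erf\<close>, and the identity, with minus the density as
  antiderivative.\<close>

lemma std_normal_tail_integral:
  assumes F: "\<And>x. (F has_real_derivative std_normal_density x * f x) (at x)"
    and f: "\<And>x. isCont f x"
    and lim: "(F \<longlongrightarrow> B) at_top"
    and int: "integrable std_normal_distribution f"
  shows "(\<integral>z. of_bool (\<nu> < z) * f z \<partial>std_normal_distribution) = B - F \<nu>"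
proof -
  have f_meas [measurable]: "f \<in> borel_measurable borel"
    using f by (intro borel_measurable_continuous_onI continuous_at_imp_continuous_on) auto
  have int': "integrable lborel (\<lambda>x. std_normal_density x * f x)"
    using int by (simp add: integrable_density)
  have ein: "einterval (ereal \<nu>) \<infinity> = {\<nu><..}" by (auto simp: einterval_def)
  have "(LBINT x=ereal \<nu>..\<infinity>. std_normal_density x * f x) = B - F \<nu>"
  proof (rule interval_integral_FTC_integrable)
    show "(F has_vector_derivative std_normal_density x * f x) (at x)" for x
      using F by (simp add: has_real_derivative_iff_has_vector_derivative)
    show "isCont (\<lambda>x. std_normal_density x * f x) x" for x
      using f unfolding std_normal_density_def by (intro continuous_intros) auto
    show "set_integrable lborel (einterval (ereal \<nu>) \<infinity>) (\<lambda>x. std_normal_density x * f x)"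
      unfolding ein set_integrable_def using int' by (intro integrable_mult_indicator) auto
    show "((F \<circ> real_of_ereal) \<longlongrightarrow> F \<nu>) (at_right (ereal \<nu>))"
      unfolding ereal_tendsto_simps
      using DERIV_isCont[OF F] by (simp add: isCont_def filterlim_at_split)
    show "((F \<circ> real_of_ereal) \<longlongrightarrow> B) (at_left \<infinity>)"
      unfolding ereal_tendsto_simps by (rule lim)
  qed simp
  moreover have "(LBINT x=ereal \<nu>..\<infinity>. std_normal_density x * f x) =
      (\<integral>x. std_normal_density x * (of_bool (\<nu> < x) * f x) \<partial>lborel)"
    unfolding interval_lebesgue_integral_def ein set_lebesgue_integral_def
    by (auto intro!: Bochner_Integration.integral_cong split: split_indicator)
  ultimately show ?thesis
    by (simp add: integral_density)
qed

lemma std_normal_tail: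
  "(\<integral>z. of_bool (\<nu> < z) \<partial>std_normal_distribution) = (1 - erf (\<nu> / sqrt 2)) / 2"
proof -
  have "(\<integral>z. of_bool (\<nu> < z) * 1 \<partial>std_normal_distribution) = 1 / 2 - erf (\<nu> / sqrt 2) / 2"
  proof (rule std_normal_tail_integral)
    show "((\<lambda>x. erf (x / sqrt 2) / 2) has_real_derivative std_normal_density x * 1) (at x)" for x
    proof -
      have "((\<lambda>x. erf (x / sqrt 2)) has_real_derivative 2 / sqrt pi * exp (- (x / sqrt 2)\<^sup>2) * (1 / sqrt 2)) (at x)"
        by (rule DERIV_chain2[OF erf_has_real_derivative DERIV_cdivide[OF DERIV_ident]])
      from DERIV_cdivide[OF this, of 2] show ?thesis
        by (simp add: std_normal_density_def power_divide real_sqrt_mult mult_ac)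
    qed
    have "((\<lambda>x. erf (x / sqrt 2)) \<longlongrightarrow> 1) at_top"
      by (rule filterlim_compose[OF erf_tendsto_1]) real_asymp
    then show "((\<lambda>x. erf (x / sqrt 2) / 2) \<longlongrightarrow> 1 / 2) at_top"
      by (intro tendsto_intros) auto
  qed auto
  then show ?thesis by (simp add: diff_divide_distrib)
qed

lemma std_normal_tail_mean:
  "(\<integral>z. of_bool (\<nu> < z) * z \<partial>std_normal_distribution) = std_normal_density \<nu>"
proof -
  have "(\<integral>z. of_bool (\<nu> < z) * z \<partial>std_normal_distribution) = 0 - (- std_normal_density \<nu>)"
  proof (rule std_normal_tail_integral)
    show "((\<lambda>x. - std_normal_density x) has_real_derivative std_normal_density x * x) (at x)" for x
    proof -
      have "((\<lambda>x. - (c * exp (- x\<^sup>2 / 2))) has_real_derivative c * exp (- x\<^sup>2 / 2) * x) (at x)" for c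
        by (auto intro!: derivative_eq_intros)
      then show ?thesis unfolding std_normal_density_def .
    qed
    have "((\<lambda>x. - (1 / sqrt (2 * pi) * exp (- x\<^sup>2 / 2))) \<longlongrightarrow> 0) at_top"
      by real_asymp
    then show "((\<lambda>x. - std_normal_density x) \<longlongrightarrow> 0) at_top"
      by (simp add: std_normal_density_def)
  qed auto
  then show ?thesis by simp
qed

section \<open>Sums of the largest coordinates\<close>

text \<open>Weak duality: each chosen coordinate is at most \<nu> plus its excess over \<nu>, and
  nonnegative excesses may be summed over all indices. Every \<nu> is admissible; a threshold with
  tail probability near \<open>k / d\<close> makes the mean of the bound sharp to leading
  order.\<close>

lemma top_sum_le:
  assumes "k \<le> d"
  shows "top_sum d k x \<le> real k * \<nu> + (\<Sum>i=1..d. max (x i - \<nu>) 0)"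
  unfolding top_sum_def
proof (rule Max.boundedI)
  fix y assume "y \<in> (\<lambda>I. \<Sum>i\<in>I. x i) ` ksubsets d k"
  then obtain I where I: "I \<subseteq> {1..d}" "card I = k" "y = (\<Sum>i\<in>I. x i)" by (auto simp: ksubsets_def)
  have "y \<le> (\<Sum>i\<in>I. \<nu> + max (x i - \<nu>) 0)"
    unfolding I(3) by (intro sum_mono) auto
  also have "\<dots> = real k * \<nu> + (\<Sum>i\<in>I. max (x i - \<nu>) 0)"
    using I by (simp add: sum.distrib)
  also have "(\<Sum>i\<in>I. max (x i - \<nu>) 0) \<le> (\<Sum>i=1..d. max (x i - \<nu>) 0)"
    using I by (intro sum_mono2) auto
  finally show "y \<le> real k * \<nu> + (\<Sum>i=1..d. max (x i - \<nu>) 0)" by simp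
qed (use ksubsets_nonempty[OF assms] in auto)

text \<open>A set of \<open>k\<close> indices comparable with \<open>J = {i. \<nu> < x i}\<close> differs from it in
  \<open>\<bar>card J - k\<bar>\<close> places, and each place costs at most \<open>\<bar>x i\<bar> \<le> \<eta> (x i)\<^sup>2 / 2 + 1 / (2 \<eta>)\<close>.\<close>
lemma top_sum_ge:
  assumes "k \<le> d" "\<eta> > 0"
  shows "(\<Sum>i=1..d. of_bool (\<nu> < x i) * x i) - \<eta> / 2 * (\<Sum>i=1..d. (x i)\<^sup>2)
      - \<bar>(\<Sum>i=1..d. of_bool (\<nu> < x i)) - real k\<bar> / (2 * \<eta>) \<le> top_sum d k x"
proof -
  define J where "J = {i \<in> {1..d}. \<nu> < x i}"
  have J: "J \<subseteq> {1..d}" "finite J" by (auto simp: J_def)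
  have ofb: "of_bool (\<nu> < x i) = (of_bool (i \<in> J) :: real)" if "i \<in> {1..d}" for i
    using that by (simp add: J_def)
  have sumJ: "(\<Sum>i=1..d. of_bool (\<nu> < x i) * x i) = (\<Sum>i\<in>J. x i)"
  proof -
    have "(\<Sum>i=1..d. of_bool (\<nu> < x i) * x i) = (\<Sum>i=1..d. if i \<in> J then x i else 0)"
      by (intro sum.cong) (auto simp: ofb)
    then show ?thesis using J by (simp only: sum_if_subset finite_atLeastAtMost)
  qed
  have cardJ: "(\<Sum>i=1..d. of_bool (\<nu> < x i)) = real (card J)"
  proof -
    have "(\<Sum>i=1..d. of_bool (\<nu> < x i) :: real) = (\<Sum>i=1..d. if i \<in> J then 1 else 0)"
      by (intro sum.cong) (auto simp: ofb)
    then show ?thesis using J by (simp only: sum_if_subset finite_atLeastAtMost) simp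
  qed
  have cost: "\<bar>\<Sum>i\<in>D. x i\<bar> \<le> \<eta> / 2 * (\<Sum>i=1..d. (x i)\<^sup>2) + real (card D) / (2 * \<eta>)"
    if D: "D \<subseteq> {1..d}" for D
  proof -
    have "\<bar>\<Sum>i\<in>D. x i\<bar> \<le> (\<Sum>i\<in>D. \<bar>x i\<bar>)" by (rule sum_abs)
    also have "\<dots> \<le> (\<Sum>i\<in>D. \<eta> / 2 * (x i)\<^sup>2 + 1 / (2 * \<eta>))"
    proof (rule sum_mono)
      fix i
      have "0 \<le> (\<eta> * \<bar>x i\<bar> - 1)\<^sup>2" by simp
      then have "2 * \<eta> * \<bar>x i\<bar> \<le> \<eta>\<^sup>2 * (x i)\<^sup>2 + 1"
        by (simp add: power2_diff power_mult_distrib)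
      then show "\<bar>x i\<bar> \<le> \<eta> / 2 * (x i)\<^sup>2 + 1 / (2 * \<eta>)"
        using assms(2) by (simp add: field_simps power2_eq_square)
    qed
    also have "\<dots> = \<eta> / 2 * (\<Sum>i\<in>D. (x i)\<^sup>2) + real (card D) / (2 * \<eta>)"
      by (simp add: sum.distrib sum_distrib_left)
    also have "\<eta> / 2 * (\<Sum>i\<in>D. (x i)\<^sup>2) \<le> \<eta> / 2 * (\<Sum>i=1..d. (x i)\<^sup>2)"
      using assms(2) D by (intro mult_left_mono sum_mono2) auto
    finally show ?thesis by simp
  qed
  have "\<exists>I\<in>ksubsets d k. (\<Sum>i\<in>J. x i) - \<eta> / 2 * (\<Sum>i=1..d. (x i)\<^sup>2) - \<bar>real (card J) - real k\<bar> / (2 * \<eta>) \<le> (\<Sum>i\<in>I. x i)"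
  proof (cases "k \<le> card J")
    \<comment> \<open>With at least \<open>k\<close> exceedances the chosen set lies inside
      \<open>J\<close> and the dropped indices are paid for; in the other case \<open>J\<close> is
      enlarged and the added indices are paid for.\<close>
    case True
    then obtain I where I: "I \<subseteq> J" "card I = k" using obtain_subset_with_card_n by metis
    have card: "real (card (J - I)) = \<bar>real (card J) - real k\<bar>"
      using I J True by (simp add: card_Diff_subset finite_subset of_nat_diff)
    have "J - I \<subseteq> {1..d}" using J by blast
    note c = cost[OF this, unfolded card]
    have "(\<Sum>i\<in>J. x i) = (\<Sum>i\<in>I. x i) + (\<Sum>i\<in>J - I. x i)"
      using I J by (simp add: sum.subset_diff)
    with c have "(\<Sum>i\<in>J. x i) - \<eta> / 2 * (\<Sum>i=1..d. (x i)\<^sup>2)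
        - \<bar>real (card J) - real k\<bar> / (2 * \<eta>) \<le> (\<Sum>i\<in>I. x i)" by linarith
    moreover have "I \<in> ksubsets d k" using I J by (auto simp: ksubsets_def)
    ultimately show ?thesis by blast
  next
    case False
    then obtain I where I: "J \<subseteq> I" "I \<subseteq> {1..d}" "card I = k"
      using exists_subset_between[of J k "{1..d}"] J assms(1) by auto
    have fin: "finite I" using I(2) by (rule finite_subset) simp
    have card: "real (card (I - J)) = \<bar>real (card J) - real k\<bar>"
      using I J False by (simp add: card_Diff_subset of_nat_diff)
    have "I - J \<subseteq> {1..d}" using I by blast
    note c = cost[OF this, unfolded card]
    have "(\<Sum>i\<in>I. x i) = (\<Sum>i\<in>J. x i) + (\<Sum>i\<in>I - J. x i)"
      using I fin by (simp add: sum.subset_diff)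
    with c have "(\<Sum>i\<in>J. x i) - \<eta> / 2 * (\<Sum>i=1..d. (x i)\<^sup>2)
        - \<bar>real (card J) - real k\<bar> / (2 * \<eta>) \<le> (\<Sum>i\<in>I. x i)" by linarith
    moreover have "I \<in> ksubsets d k" using I by (auto simp: ksubsets_def)
    ultimately show ?thesis by blast
  qed
  then obtain I where I: "I \<in> ksubsets d k"
    "(\<Sum>i\<in>J. x i) - \<eta> / 2 * (\<Sum>i=1..d. (x i)\<^sup>2) - \<bar>real (card J) - real k\<bar> / (2 * \<eta>) \<le> (\<Sum>i\<in>I. x i)"
    by blast
  have "(\<Sum>i\<in>I. x i) \<le> top_sum d k x"
    unfolding top_sum_def using I(1) by (intro Max_ge) auto
  with I(2) show ?thesis unfolding sumJ cardJ by linarith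
qed

context prob_space
begin

lemma std_normal_distr_eq:
  "distributed M lborel X std_normal_density \<Longrightarrow> distr M lborel X = std_normal_distribution"
  by (rule distributed_distr_eq_density)

lemma std_normal_expectation_eq:
  fixes F :: "real \<Rightarrow> real"
  assumes "distributed M lborel X std_normal_density" and [measurable]: "F \<in> borel_measurable borel"
  shows "expectation (\<lambda>w. F (X w)) = (\<integral>z. F z \<partial>std_normal_distribution)"
proof -
  have "X \<in> measurable M lborel" by (rule distributed_measurable[OF assms(1)])
  from integral_distr[OF this, of F] show ?thesis
    by (simp add: std_normal_distr_eq[OF assms(1)])
qed

lemma std_normal_integrable_compose:
  fixes F :: "real \<Rightarrow> real"
  assumes "distributed M lborel X std_normal_density" and [measurable]: "F \<in> borel_measurable borel"
    and "integrable std_normal_distribution F"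
  shows "integrable M (\<lambda>w. F (X w))"
proof -
  have "X \<in> measurable M lborel" by (rule distributed_measurable[OF assms(1)])
  from integrable_distr[OF this, of F] show ?thesis
    using assms(3) by (simp add: std_normal_distr_eq[OF assms(1)])
qed

text \<open>The bounds are the means of \<open>top_sum_le\<close> and \<open>top_sum_ge\<close>. In
  the second, the number of exceedances has mean \<open>d * q\<close> and mean absolute deviation at
  most \<open>sqrt d\<close>. The parameter \<eta> stays free and is matched to the desired
  precision when the limit is taken.\<close>

lemma expectation_top_sum_bounds:
  fixes Z :: "nat \<Rightarrow> 'a \<Rightarrow> real" and \<nu> :: real
  defines "q \<equiv> (1 - erf (\<nu> / sqrt 2)) / 2"
  assumes k: "k \<le> d" "0 < d" and \<eta>: "\<eta> > 0"
    and D: "\<And>i. i \<in> {1..d} \<Longrightarrow> distributed M lborel (Z i) std_normal_density"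
    and ind: "indep_vars (\<lambda>_. borel) Z {1..d}"
  shows "integrable M (\<lambda>w. top_sum d k (\<lambda>i. Z i w))"
    and "expectation (\<lambda>w. top_sum d k (\<lambda>i. Z i w)) \<le>
      real k * \<nu> + real d * (std_normal_density \<nu> - \<nu> * q)"
    and "real d * std_normal_density \<nu> - \<eta> / 2 * real d - (\<bar>real d * q - real k\<bar> + sqrt (real d)) / (2 * \<eta>) \<le>
      expectation (\<lambda>w. top_sum d k (\<lambda>i. Z i w))"
proof -
  let ?N = "std_normal_distribution"
  let ?T = "\<lambda>w. top_sum d k (\<lambda>i. Z i w)"
  let ?p = "\<lambda>z. of_bool (\<nu> < z) :: real"
  note EZ = std_normal_expectation_eq[OF D] and IZ = std_normal_integrable_compose[OF D]
  show int_T: "integrable M ?T"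
  proof -
    define ks where "ks = [1..<Suc d]"
    have ks: "set ks = {1..d}" "distinct ks" "ks \<noteq> []" using k by (auto simp: ks_def)
    \<comment> \<open>Selecting \<open>I\<close> through 0-1 coefficients makes the maximum a
      Lipschitz function of a linear image of \<open>Z\<close>.\<close>
    have "integrable M (\<lambda>w. Max ((\<lambda>I. \<Sum>i\<in>{1..d}. Z i w * of_bool (i \<in> I)) ` ksubsets d k))"
      using expectation_std_normal_gsmooths(2)[OF lip_Max[OF finite_ksubsets ksubsets_nonempty[OF k(1)]] ks(2,3),
          of Z "\<lambda>i I. of_bool (i \<in> I)"] ind D by (simp add: ks(1))
    moreover have "(\<lambda>I. \<Sum>i\<in>{1..d}. Z i w * of_bool (i \<in> I)) ` ksubsets d k = (\<lambda>I. \<Sum>i\<in>I. Z i w) ` ksubsets d k" for w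
    proof (rule image_cong[OF refl])
      fix I assume "I \<in> ksubsets d k"
      then have "I \<subseteq> {1..d}" by (simp add: ksubsets_def)
      have "(\<Sum>i\<in>{1..d}. Z i w * of_bool (i \<in> I)) = (\<Sum>i\<in>{1..d}. if i \<in> I then Z i w else 0)"
        by (intro sum.cong) auto
      also have "\<dots> = (\<Sum>i\<in>I. Z i w)"
        using \<open>I \<subseteq> {1..d}\<close> by (intro sum_if_subset) auto
      finally show "(\<Sum>i\<in>{1..d}. Z i w * of_bool (i \<in> I)) = (\<Sum>i\<in>I. Z i w)" .
    qed
    ultimately show ?thesis by (simp add: top_sum_def)
  qed
  have p_int: "integrable ?N ?p"
    by (rule std_normal.integrable_const_bound[of _ 1]) auto
  have pz_int: "integrable ?N (\<lambda>z. ?p z * z)"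
    by (rule Bochner_Integration.integrable_bound[OF std_normal_integrable_id(2)]) auto
  \<comment> \<open>The mean excess over \<nu> thus splits into a tail mean and a tail probability,
    both known.\<close>
  have plus_eq: "max (z - \<nu>) 0 = ?p z * z - \<nu> * ?p z" for z by (auto simp: max_def)
  have plus: "(\<integral>z. max (z - \<nu>) 0 \<partial>?N) = std_normal_density \<nu> - \<nu> * q"
    unfolding plus_eq using p_int pz_int by (simp add: std_normal_tail std_normal_tail_mean q_def)
  have plus_int: "integrable ?N (\<lambda>z. max (z - \<nu>) 0)"
    unfolding plus_eq using p_int pz_int by simp
  have IP: "integrable M (\<lambda>w. max (Z i w - \<nu>) 0)" if "i \<in> {1..d}" for i
    by (rule IZ[OF that _ plus_int]) simp
  have "expectation ?T \<le> expectation (\<lambda>w. real k * \<nu> + (\<Sum>i=1..d. max (Z i w - \<nu>) 0))"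
    by (intro integral_mono int_T top_sum_le[OF k(1)] Bochner_Integration.integrable_add
        Bochner_Integration.integrable_sum IP) auto
  also have "\<dots> = real k * \<nu> + (\<Sum>i=1..d. expectation (\<lambda>w. max (Z i w - \<nu>) 0))"
  proof -
    have "expectation (\<lambda>w. \<Sum>i=1..d. max (Z i w - \<nu>) 0) = (\<Sum>i=1..d. expectation (\<lambda>w. max (Z i w - \<nu>) 0))"
      by (rule Bochner_Integration.integral_sum) (rule IP)
    moreover have "integrable M (\<lambda>w. \<Sum>i=1..d. max (Z i w - \<nu>) 0)"
      by (intro Bochner_Integration.integrable_sum IP)
    ultimately show ?thesis by (simp add: prob_space)
  qed
  also have "\<dots> = real k * \<nu> + real d * (std_normal_density \<nu> - \<nu> * q)"
    using EZ[where F = "\<lambda>z. max (z - \<nu>) 0"] plus by simp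
  finally show "expectation ?T \<le> real k * \<nu> + real d * (std_normal_density \<nu> - \<nu> * q)" .

  \<comment> \<open>Centred exceedance indicators. They are independent, have mean 0 and are bounded
    by 1, so the cross terms of the squared sum vanish in mean and at most \<open>d\<close>
    remains.\<close>
  define W where "W i w = ?p (Z i w) - q" for i w
  have q01: "0 \<le> q" "q \<le> 1"
  proof -
    have "q = (\<integral>z. ?p z \<partial>?N)" by (simp add: std_normal_tail q_def)
    moreover have "0 \<le> (\<integral>z. ?p z \<partial>?N)" by (rule Bochner_Integration.integral_nonneg) auto
    moreover have "(\<integral>z. ?p z \<partial>?N) \<le> (\<integral>z. 1 \<partial>?N)" using p_int by (intro integral_mono) auto
    ultimately show "0 \<le> q" "q \<le> 1" using std_normal.prob_space by auto
  qed
  have Z_meas: "Z i \<in> borel_measurable M" if "i \<in> {1..d}" for i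
    using distributed_measurable[OF D[OF that]] by simp
  have W_meas: "W i \<in> borel_measurable M" if "i \<in> {1..d}" for i
    unfolding W_def using Z_meas[OF that] by measurable
  have W_le: "\<bar>W i w\<bar> \<le> 1" for i w using q01 by (auto simp: W_def)
  have W_int: "integrable M (W i)" if "i \<in> {1..d}" for i
    using W_meas[OF that] W_le by (intro integrable_const_bound[of _ 1]) auto
  have WW_int: "integrable M (\<lambda>w. W i w * W j w)" if "i \<in> {1..d}" "j \<in> {1..d}" for i j
    using W_meas[OF that(1)] W_meas[OF that(2)] W_le
    by (intro integrable_const_bound[of _ 1]) (auto simp: abs_mult intro!: mult_le_one)
  have EW: "expectation (W i) = 0" if "i \<in> {1..d}" for i
    unfolding W_def using EZ[OF that, of ?p] IZ[OF that, of ?p] p_int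
    by (simp add: std_normal_tail q_def prob_space)
  have indW: "indep_vars (\<lambda>_. borel) W {1..d}"
    unfolding W_def by (rule indep_vars_compose2[OF ind]) measurable
  have EWW: "expectation (\<lambda>w. W i w * W j w) \<le> of_bool (i = j)" if ij: "i \<in> {1..d}" "j \<in> {1..d}" for i j
  proof (cases "i = j")
    case True
    have "expectation (\<lambda>w. W i w * W j w) \<le> expectation (\<lambda>_. 1)"
    proof (rule integral_mono[OF WW_int[OF ij]])
      show "W i w * W j w \<le> 1" for w
        using mult_le_one[OF W_le abs_ge_zero W_le, of i w j w] abs_ge_self[of "W i w * W j w"]
        by (simp add: abs_mult)
    qed simp
    then show ?thesis using True by (simp add: prob_space)
  next
    case False
    have "expectation (\<lambda>w. \<Prod>l\<in>{i, j}. W l w) = (\<Prod>l\<in>{i, j}. expectation (W l))"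
      using ij by (intro indep_vars_lebesgue_integral indep_vars_subset[OF indW] W_int) auto
    then show ?thesis using False EW ij by simp
  qed
  define Y where "Y w = (\<Sum>i=1..d. W i w)" for w
  have Y_int: "integrable M Y" unfolding Y_def by (intro Bochner_Integration.integrable_sum W_int)
  have Y2: "(Y w)\<^sup>2 = (\<Sum>i=1..d. \<Sum>j=1..d. W i w * W j w)" for w
    by (simp add: Y_def power2_eq_square sum_product)
  have Y2_int: "integrable M (\<lambda>w. (Y w)\<^sup>2)" unfolding Y2
    by (intro Bochner_Integration.integrable_sum WW_int)
  have "expectation (\<lambda>w. (Y w)\<^sup>2) = (\<Sum>i=1..d. \<Sum>j=1..d. expectation (\<lambda>w. W i w * W j w))"
    unfolding Y2
    by (subst Bochner_Integration.integral_sum, intro Bochner_Integration.integrable_sum WW_int, assumption+)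
      (intro sum.cong refl Bochner_Integration.integral_sum WW_int)
  also have "\<dots> \<le> (\<Sum>i=1..d. \<Sum>j=1..d. of_bool (i = j))"
    by (intro sum_mono EWW)
  also have "\<dots> = real d" by (simp add: of_bool_def)
  finally have EY2: "expectation (\<lambda>w. (Y w)\<^sup>2) \<le> real d" .
  have EY: "expectation (\<lambda>w. \<bar>Y w\<bar>) \<le> sqrt (real d)"
  proof -
    let ?r = "sqrt (real d)"
    have r: "?r > 0" "real d / ?r = ?r" using k by (simp_all add: real_div_sqrt)
    \<comment> \<open>A pointwise form of Cauchy-Schwarz; the choice \<open>?r = sqrt d\<close>
      balances its two terms.\<close>
    have "expectation (\<lambda>w. \<bar>Y w\<bar>) \<le> expectation (\<lambda>w. (Y w)\<^sup>2 / (2 * ?r) + ?r / 2)"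
    proof (intro integral_mono)
      fix w
      have "0 \<le> (\<bar>Y w\<bar> - ?r)\<^sup>2" by simp
      then have "2 * \<bar>Y w\<bar> * ?r \<le> (Y w)\<^sup>2 + ?r * ?r" by (simp add: power2_diff)
      then show "\<bar>Y w\<bar> \<le> (Y w)\<^sup>2 / (2 * ?r) + ?r / 2"
        using r(1) by (simp add: field_simps)
    qed (use Y_int Y2_int in auto)
    also have "\<dots> = expectation (\<lambda>w. (Y w)\<^sup>2) / (2 * ?r) + ?r / 2"
      using Y2_int by (simp add: prob_space)
    also have "\<dots> \<le> real d / (2 * ?r) + ?r / 2"
      using EY2 r by (intro add_right_mono divide_right_mono) auto
    also have "real d / (2 * ?r) = ?r / 2" using r(2) by simp
    finally show ?thesis by simp
  qed
  have count: "\<bar>(\<Sum>i=1..d. ?p (Z i w)) - real k\<bar> \<le> \<bar>real d * q - real k\<bar> + \<bar>Y w\<bar>" for w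
    by (simp add: Y_def W_def sum_subtractf)
  have sq_int: "integrable ?N (\<lambda>z. z\<^sup>2)" by (rule std_normal_integrable_power)
  let ?R = "\<lambda>w. (\<Sum>i=1..d. ?p (Z i w) * Z i w) - \<eta> / 2 * (\<Sum>i=1..d. (Z i w)\<^sup>2)
      - (\<bar>real d * q - real k\<bar> + \<bar>Y w\<bar>) / (2 * \<eta>)"
  have int1: "integrable M (\<lambda>w. \<Sum>i=1..d. ?p (Z i w) * Z i w)"
    using pz_int by (intro Bochner_Integration.integrable_sum IZ[where F = "\<lambda>z. ?p z * z"]) auto
  have int2: "integrable M (\<lambda>w. \<Sum>i=1..d. (Z i w)\<^sup>2)"
    using sq_int by (intro Bochner_Integration.integrable_sum IZ[where F = "\<lambda>z. z\<^sup>2"]) auto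
  have int3: "integrable M (\<lambda>w. (\<bar>real d * q - real k\<bar> + \<bar>Y w\<bar>) / (2 * \<eta>))"
    using Y_int by simp
  have ER: "expectation ?R = real d * std_normal_density \<nu> - \<eta> / 2 * real d
      - (\<bar>real d * q - real k\<bar> + expectation (\<lambda>w. \<bar>Y w\<bar>)) / (2 * \<eta>)"
  proof -
    have 1: "expectation (\<lambda>w. \<Sum>i=1..d. ?p (Z i w) * Z i w) = real d * std_normal_density \<nu>"
      using EZ[where F = "\<lambda>z. ?p z * z"] IZ[where F = "\<lambda>z. ?p z * z"] pz_int std_normal_tail_mean[of \<nu>]
      by (subst Bochner_Integration.integral_sum) simp_all
    have 2: "expectation (\<lambda>w. \<Sum>i=1..d. (Z i w)\<^sup>2) = real d"
      using EZ[where F = "\<lambda>z. z\<^sup>2"] IZ[where F = "\<lambda>z. z\<^sup>2"] sq_int std_normal_second_moment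
      by (subst Bochner_Integration.integral_sum) simp_all
    have 3: "expectation (\<lambda>w. (\<bar>real d * q - real k\<bar> + \<bar>Y w\<bar>) / (2 * \<eta>)) =
        (\<bar>real d * q - real k\<bar> + expectation (\<lambda>w. \<bar>Y w\<bar>)) / (2 * \<eta>)"
      using Y_int by (simp add: prob_space)
    show ?thesis
      using int1 int2 int3 by (simp only: Bochner_Integration.integral_diff integral_mult_right_zero 1 2 3
          integrable_mult_right Bochner_Integration.integrable_diff)
  qed
  have "expectation ?R \<le> expectation ?T"
  proof (intro integral_mono int_T)
    show "integrable M ?R" using int1 int2 int3 by simp
    fix w
    have "\<bar>(\<Sum>i=1..d. ?p (Z i w)) - real k\<bar> / (2 * \<eta>) \<le> (\<bar>real d * q - real k\<bar> + \<bar>Y w\<bar>) / (2 * \<eta>)"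
      using count \<eta> by (intro divide_right_mono) auto
    then show "?R w \<le> ?T w"
      using top_sum_ge[OF k(1) \<eta>, of \<nu> "\<lambda>i. Z i w"] by linarith
  qed
  moreover have "(\<bar>real d * q - real k\<bar> + expectation (\<lambda>w. \<bar>Y w\<bar>)) / (2 * \<eta>) \<le>
      (\<bar>real d * q - real k\<bar> + sqrt (real d)) / (2 * \<eta>)"
    using EY \<eta> by (intro divide_right_mono) auto
  ultimately show "real d * std_normal_density \<nu> - \<eta> / 2 * real d
      - (\<bar>real d * q - real k\<bar> + sqrt (real d)) / (2 * \<eta>) \<le> expectation ?T"
    unfolding ER by linarith
qed

end

text \<open>Divided by \<open>d\<close>, the two bounds of \<open>expectation_top_sum_bounds\<close> tend to \<open>std_normal_density \<nu>\<close> and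
  \<open>std_normal_density \<nu> - \<eta> / 2\<close>.\<close>
lemma top_sum_limit:
  fixes d k :: "nat \<Rightarrow> nat" and M :: "nat \<Rightarrow> 'a measure" and Z :: "nat \<Rightarrow> nat \<Rightarrow> 'a \<Rightarrow> real"
  assumes M: "\<forall>\<^sub>F n in sequentially. prob_space (M n)"
    and D: "\<forall>\<^sub>F n in sequentially. \<forall>i\<in>{1..d n}. distributed (M n) lborel (Z n i) std_normal_density"
    and ind: "\<forall>\<^sub>F n in sequentially. prob_space.indep_vars (M n) (\<lambda>_. borel) (Z n) {1..d n}"
    and d: "filterlim d at_top sequentially"
    and k: "(\<lambda>n. real (k n) / real (d n)) \<longlonglongrightarrow> (1 - erf (\<nu> / sqrt 2)) / 2"
    and kd: "\<forall>\<^sub>F n in sequentially. k n \<le> d n"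
  shows "(\<lambda>n. integral\<^sup>L (M n) (\<lambda>w. top_sum (d n) (k n) (\<lambda>i. Z n i w)) / real (d n)) \<longlonglongrightarrow> std_normal_density \<nu>"
proof -
  define q where "q = (1 - erf (\<nu> / sqrt 2)) / 2"
  define E where "E n = integral\<^sup>L (M n) (\<lambda>w. top_sum (d n) (k n) (\<lambda>i. Z n i w)) / real (d n)" for n
  have d0: "\<forall>\<^sub>F n in sequentially. 0 < d n"
    using d[unfolded filterlim_at_top, rule_format, of 1] by eventually_elim simp
  have sqrt_d: "(\<lambda>n. 1 / sqrt (real (d n))) \<longlonglongrightarrow> 0"
    by (intro tendsto_divide_0[OF tendsto_const] filterlim_at_top_imp_at_infinity
        filterlim_compose[OF sqrt_at_top] filterlim_compose[OF filterlim_real_sequentially d])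
  have upper: "\<forall>\<^sub>F n in sequentially. E n \<le> real (k n) / real (d n) * \<nu> + (std_normal_density \<nu> - \<nu> * q)"
    using M D ind kd d0
  proof eventually_elim
    case (elim n)
    interpret prob_space "M n" by fact
    have "E n \<le> (real (k n) * \<nu> + real (d n) * (std_normal_density \<nu> - \<nu> * q)) / real (d n)"
      unfolding E_def q_def using elim
      by (intro divide_right_mono expectation_top_sum_bounds(2)[where \<eta> = 1]) auto
    then show ?case using elim by (simp add: add_divide_distrib)
  qed
  have lower: "\<forall>\<^sub>F n in sequentially. std_normal_density \<nu> - \<eta> / 2
      - (\<bar>q - real (k n) / real (d n)\<bar> + 1 / sqrt (real (d n))) / (2 * \<eta>) \<le> E n" if "\<eta> > 0" for \<eta>
    using M D ind kd d0
  proof eventually_elim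
    case (elim n)
    interpret prob_space "M n" by fact
    have "(real (d n) * std_normal_density \<nu> - \<eta> / 2 * real (d n)
        - (\<bar>real (d n) * q - real (k n)\<bar> + sqrt (real (d n))) / (2 * \<eta>)) / real (d n) \<le> E n"
      unfolding E_def q_def using elim that
      by (intro divide_right_mono expectation_top_sum_bounds(3)) auto
    moreover have "\<bar>real (d n) * q - real (k n)\<bar> / real (d n) = \<bar>q - real (k n) / real (d n)\<bar>"
    proof -
      have "\<bar>real (d n) * q - real (k n)\<bar> / real (d n) = \<bar>(real (d n) * q - real (k n)) / real (d n)\<bar>" by simp
      then show ?thesis using elim by (simp add: diff_divide_distrib)
    qed
    moreover have "sqrt (real (d n)) / real (d n) = 1 / sqrt (real (d n))"
      using elim by (simp add: field_simps)
    moreover have "(real (d n) * p - \<eta> / 2 * real (d n) - (a + s) / (2 * \<eta>)) / real (d n) =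
        p - \<eta> / 2 - (a / real (d n) + s / real (d n)) / (2 * \<eta>)" for p a s
      using elim that by (simp add: field_simps)
    ultimately show ?case by simp
  qed
  have "E \<longlonglongrightarrow> std_normal_density \<nu>"
  proof (rule order_tendstoI)
    fix a assume a: "a < std_normal_density \<nu>"
    \<comment> \<open>With \<eta> equal to the gap, the lower bound tends to a value half the gap
      above \<open>a\<close>.\<close>
    define \<eta> where "\<eta> = std_normal_density \<nu> - a"
    have \<eta>: "\<eta> > 0" using a by (simp add: \<eta>_def)
    have "(\<lambda>n. std_normal_density \<nu> - \<eta> / 2
      - (\<bar>q - real (k n) / real (d n)\<bar> + 1 / sqrt (real (d n))) / (2 * \<eta>)) \<longlonglongrightarrow>
      std_normal_density \<nu> - \<eta> / 2 - (\<bar>q - q\<bar> + 0) / (2 * \<eta>)"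
      using k[folded q_def] sqrt_d \<eta> by (intro tendsto_intros) auto
    moreover have "a < std_normal_density \<nu> - \<eta> / 2 - (\<bar>q - q\<bar> + 0) / (2 * \<eta>)"
      using \<eta> by (simp add: \<eta>_def field_simps)
    ultimately have "\<forall>\<^sub>F n in sequentially. a < std_normal_density \<nu> - \<eta> / 2
      - (\<bar>q - real (k n) / real (d n)\<bar> + 1 / sqrt (real (d n))) / (2 * \<eta>)"
      by (rule order_tendstoD(1))
    then show "\<forall>\<^sub>F n in sequentially. a < E n"
      using lower[OF \<eta>] by eventually_elim linarith
  next
    fix a assume a: "std_normal_density \<nu> < a"
    \<comment> \<open>Since \<nu> has exactly the limiting fraction as its tail probability, the
      \<nu> terms cancel in the limit and only the density is left.\<close>
    have "(\<lambda>n. real (k n) / real (d n) * \<nu> + (std_normal_density \<nu> - \<nu> * q)) \<longlonglongrightarrow>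
      q * \<nu> + (std_normal_density \<nu> - \<nu> * q)"
      using k[folded q_def] by (intro tendsto_intros)
    from order_tendstoD(2)[OF this, of a]
    have "\<forall>\<^sub>F n in sequentially. real (k n) / real (d n) * \<nu> + (std_normal_density \<nu> - \<nu> * q) < a"
      using a by (simp add: mult.commute)
    then show "\<forall>\<^sub>F n in sequentially. E n < a"
      using upper by eventually_elim linarith
  qed
  then show ?thesis by (simp add: E_def[abs_def])
qed

section \<open>The limit\<close>

lemma I_fun_sqrt2:
  "I_fun (sqrt 2 * x) = sqrt 2 * x * ((1 - erf x) / 2) - exp (- x\<^sup>2) / sqrt (2 * pi)"
  by (simp add: I_fun_def erfc_def power_mult_distrib)

lemma std_normal_density_sqrt2:
  "std_normal_density (sqrt 2 * x) = exp (- x\<^sup>2) / sqrt (2 * pi)"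
  by (simp add: std_normal_density_def power_mult_distrib)

text \<open>At the hat values the normal tails are \<beta>1 / \<alpha> and \<beta>2. These are the
  stationarity conditions of \<open>omega\<close>, because \<open>I_fun\<close> has derivative
  \<open>erfc (\<nu> / sqrt 2) / 2\<close>; there the terms with an explicit factor \<nu> cancel and
  the densities survive.\<close>

lemma omega_hat:
  assumes "0 < \<beta>1" "\<beta>1 < \<alpha>" "0 < \<beta>2" "\<beta>2 < 1"
  shows "omega \<alpha> \<beta>1 \<beta>2 (nu1_hat \<alpha> \<beta>1) (nu2_hat \<beta>2) =
    \<alpha> / sqrt \<beta>1 * (exp (- (erfinv (1 - 2 * \<beta>1 / \<alpha>))\<^sup>2) / sqrt (2 * pi))
      + 1 / sqrt \<beta>2 * (exp (- (erfinv (1 - 2 * \<beta>2))\<^sup>2) / sqrt (2 * pi))"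
proof -
  have "erf (erfinv (1 - 2 * \<beta>1 / \<alpha>)) = 1 - 2 * \<beta>1 / \<alpha>"
    using assms by (intro erf_erfinv) (auto simp: field_simps)
  then have 1: "(1 - erf (erfinv (1 - 2 * \<beta>1 / \<alpha>))) / 2 = \<beta>1 / \<alpha>" by simp
  have "erf (erfinv (1 - 2 * \<beta>2)) = 1 - 2 * \<beta>2"
    using assms by (intro erf_erfinv) auto
  then have 2: "(1 - erf (erfinv (1 - 2 * \<beta>2))) / 2 = \<beta>2" by simp
  have cancel: "- (c / sqrt b) * (\<nu> * (b / c) - e) + \<nu> * sqrt b = c / sqrt b * e"
    if "b > 0" "c > 0" for b c \<nu> e :: real
  proof -
    have "c / sqrt b * (\<nu> * (b / c)) = \<nu> * (b / sqrt b)"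
      using that by simp
    also have "b / sqrt b = sqrt b" using that by (intro real_div_sqrt) simp
    finally show ?thesis by (simp add: right_diff_distrib)
  qed
  have c1: "- (\<alpha> / sqrt \<beta>1) * (\<nu> * (\<beta>1 / \<alpha>) - e) + \<nu> * sqrt \<beta>1 = \<alpha> / sqrt \<beta>1 * e" for \<nu> e
    using assms by (intro cancel) auto
  have c2: "- (1 / sqrt \<beta>2) * (\<nu> * \<beta>2 - e) + \<nu> * sqrt \<beta>2 = 1 / sqrt \<beta>2 * e" for \<nu> e
    using cancel[of \<beta>2 1 \<nu> e] assms by simp
  show ?thesis
    using c1[of "sqrt 2 * erfinv (1 - 2 * \<beta>1 / \<alpha>)" "exp (- (erfinv (1 - 2 * \<beta>1 / \<alpha>))\<^sup>2) / sqrt (2 * pi)"]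
      c2[of "sqrt 2 * erfinv (1 - 2 * \<beta>2)" "exp (- (erfinv (1 - 2 * \<beta>2))\<^sup>2) / sqrt (2 * pi)"]
    unfolding omega_def nu1_hat_def nu2_hat_def I_fun_sqrt2 1 2 by linarith
qed

text \<open>The limit on the left is rendered by \<open>limsup\<close>, which also covers the case
  that it does not exist. The ranges of \<beta>1 and \<beta>2 place the arguments of
  \<open>erfinv\<close> in (-1, 1) and make the submatrix sizes admissible for large
  \<open>n\<close>.\<close>

theorem theorem3:
  fixes m k1 k2 :: "nat \<Rightarrow> nat"
    and \<alpha> \<beta>1 \<beta>2 :: real
    and M :: "nat \<Rightarrow> 'a measure"
    and A :: "nat \<Rightarrow> nat \<Rightarrow> nat \<Rightarrow> 'a \<Rightarrow> real"
    and h g :: "nat \<Rightarrow> nat \<Rightarrow> 'a \<Rightarrow> real"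
  assumes "\<And>n. n > 0 \<Longrightarrow> m n > 0 \<and> k1 n > 0 \<and> k2 n > 0"
    and "(\<lambda>n. real (m n) / real n) \<longlonglongrightarrow> \<alpha>"
    and "(\<lambda>n. real (k1 n) / real n) \<longlonglongrightarrow> \<beta>1"
    and "(\<lambda>n. real (k2 n) / real n) \<longlonglongrightarrow> \<beta>2"
    and "0 < \<beta>1" "\<beta>1 < \<alpha>" "0 < \<beta>2" "\<beta>2 < 1"
    and "\<And>n. n > 0 \<Longrightarrow> prob_space (M n)"
    and "\<And>n i j. n > 0 \<Longrightarrow> i \<in> {1..m n} \<Longrightarrow> j \<in> {1..n} \<Longrightarrow>
           distributed (M n) lborel (A n i j) std_normal_density"
    and "\<And>n i. n > 0 \<Longrightarrow> i \<in> {1..m n} \<Longrightarrow> distributed (M n) lborel (h n i) std_normal_density"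
    and "\<And>n j. n > 0 \<Longrightarrow> j \<in> {1..n} \<Longrightarrow> distributed (M n) lborel (g n j) std_normal_density"
    and "\<And>n. n > 0 \<Longrightarrow>
           prob_space.indep_vars (M n) (\<lambda>_. borel)
             (case_sum (\<lambda>(i, j). A n i j) (case_sum (h n) (g n)))
             (({1..m n} \<times> {1..n}) <+> ({1..m n} <+> {1..n}))"
  defines "E_xi \<equiv> \<lambda>n. prob_space.expectation (M n)
             (\<lambda>w. max_avg_submatrix (m n) n (k1 n) (k2 n) (\<lambda>i j. A n i j w))"
    and "E_L \<equiv> \<lambda>n. prob_space.expectation (M n)
             (\<lambda>w. decoupled_max (m n) n (k1 n) (k2 n) (\<lambda>i. h n i w) (\<lambda>j. g n j w))"
  shows "limsup (\<lambda>n. ereal (E_xi n * sqrt (real n))) \<le> ereal (lim (\<lambda>n. E_L n * sqrt (real n)))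
    \<and> (\<lambda>n. E_L n * sqrt (real n)) \<longlonglongrightarrow>
          1 / sqrt (\<beta>1 * \<beta>2) * omega \<alpha> \<beta>1 \<beta>2 (nu1_hat \<alpha> \<beta>1) (nu2_hat \<beta>2)
    \<and> 1 / sqrt (\<beta>1 * \<beta>2) * omega \<alpha> \<beta>1 \<beta>2 (nu1_hat \<alpha> \<beta>1) (nu2_hat \<beta>2) =
          1 / sqrt (\<beta>1 * \<beta>2) *
            (\<alpha> / sqrt \<beta>1 * (exp (- (erfinv (1 - 2 * \<beta>1 / \<alpha>))\<^sup>2) / sqrt (2 * pi))
             + 1 / sqrt \<beta>2 * (exp (- (erfinv (1 - 2 * \<beta>2))\<^sup>2) / sqrt (2 * pi)))"
proof -
  note pos = assms(1) and m_lim = assms(2) and k1_lim = assms(3) and k2_lim = assms(4)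
    and \<beta> = assms(5-8) and M = assms(9) and A = assms(10) and h = assms(11) and g = assms(12) and ind = assms(13)
  have \<alpha>: "\<alpha> > 0" using \<beta> by linarith
  define \<nu>1 \<nu>2 where "\<nu>1 = nu1_hat \<alpha> \<beta>1" and "\<nu>2 = nu2_hat \<beta>2"
  let ?\<omega> = "omega \<alpha> \<beta>1 \<beta>2 (nu1_hat \<alpha> \<beta>1) (nu2_hat \<beta>2)"
  have n0: "\<forall>\<^sub>F n in sequentially. 0 < n" by (rule eventually_gt_at_top)
  have "(\<lambda>n. real (m n) / real n - real (k1 n) / real n) \<longlonglongrightarrow> \<alpha> - \<beta>1"
    by (intro tendsto_diff m_lim k1_lim)
  from order_tendstoD(1)[OF this, of 0] \<beta>
  have "\<forall>\<^sub>F n in sequentially. 0 < real (m n) / real n - real (k1 n) / real n" by simp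
  \<comment> \<open>For such \<open>n\<close> the maxima range over nonempty sets. For small
    \<open>n\<close> they may be an unspecified \<open>Max\<close> of the empty set, so the
    estimates are made eventually.\<close>
  then have k1m: "\<forall>\<^sub>F n in sequentially. k1 n \<le> m n"
    using n0 by eventually_elim (simp add: field_simps)
  have k2n: "\<forall>\<^sub>F n in sequentially. k2 n \<le> n"
    using order_tendstoD(2)[OF k2_lim \<beta>(4)] n0 by eventually_elim (simp add: field_simps)
  \<comment> \<open>\<open>top_sum_limit\<close> needs the dimension to grow; here
    \<open>m / n\<close> has a positive limit.\<close>
  have "filterlim (\<lambda>n. real (m n) / real n * real n) at_top sequentially"
    by (rule filterlim_tendsto_pos_mult_at_top[OF m_lim \<alpha> filterlim_real_sequentially])
  then have "filterlim (\<lambda>n. real (m n)) at_top sequentially"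
    by (rule filterlim_mono_eventually[OF _ order_refl order_refl])
      (use n0 in eventually_elim, simp)
  then have m_top: "filterlim m at_top sequentially"
    by (simp add: filterlim_sequentially_iff_filterlim_real)
  have "(\<lambda>n. (real (k1 n) / real n) / (real (m n) / real n)) \<longlonglongrightarrow> \<beta>1 / \<alpha>"
    using \<alpha> by (intro tendsto_divide k1_lim m_lim) simp
  then have k1_m_lim: "(\<lambda>n. real (k1 n) / real (m n)) \<longlonglongrightarrow> \<beta>1 / \<alpha>"
    by (rule Lim_transform_eventually) (use n0 in eventually_elim, simp)
  \<comment> \<open>The hat values are the thresholds whose tail probabilities equal the limiting
    fractions \<open>k1 / m\<close> and \<open>k2 / n\<close>.\<close>
  have q1: "(1 - erf (\<nu>1 / sqrt 2)) / 2 = \<beta>1 / \<alpha>"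
    using erf_erfinv[of "1 - 2 * \<beta>1 / \<alpha>"] \<beta> \<alpha> by (simp add: \<nu>1_def nu1_hat_def field_simps)
  have q2: "(1 - erf (\<nu>2 / sqrt 2)) / 2 = \<beta>2"
    using erf_erfinv[of "1 - 2 * \<beta>2"] \<beta> by (simp add: \<nu>2_def nu2_hat_def)
  have indh: "prob_space.indep_vars (M n) (\<lambda>_. borel) (h n) {1..m n}"
    and indg: "prob_space.indep_vars (M n) (\<lambda>_. borel) (g n) {1..n}" if n: "n > 0" for n
  proof -
    interpret prob_space "M n" using M n .
    have "indep_vars (\<lambda>_. borel) (\<lambda>i. case_sum (\<lambda>(i, j). A n i j) (case_sum (h n) (g n)) (Inr (Inl i))) {1..m n}"
      by (rule indep_vars_reindex[where f = "\<lambda>i. Inr (Inl i)"])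
        (auto intro!: inj_onI indep_vars_subset[OF ind[OF n]])
    then show "indep_vars (\<lambda>_. borel) (h n) {1..m n}" by simp
    have "indep_vars (\<lambda>_. borel) (\<lambda>i. case_sum (\<lambda>(i, j). A n i j) (case_sum (h n) (g n)) (Inr (Inr i))) {1..n}"
      by (rule indep_vars_reindex[where f = "\<lambda>i. Inr (Inr i)"])
        (auto intro!: inj_onI indep_vars_subset[OF ind[OF n]])
    then show "indep_vars (\<lambda>_. borel) (g n) {1..n}" by simp
  qed
  define T1 T2 where "T1 n = integral\<^sup>L (M n) (\<lambda>w. top_sum (m n) (k1 n) (\<lambda>i. h n i w)) / real (m n)"
    and "T2 n = integral\<^sup>L (M n) (\<lambda>w. top_sum n (k2 n) (\<lambda>j. g n j w)) / real n" for n
  have M': "\<forall>\<^sub>F n in sequentially. prob_space (M n)"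
    using n0 by eventually_elim (rule M)
  have T1: "T1 \<longlonglongrightarrow> std_normal_density \<nu>1"
    unfolding T1_def
  proof (rule top_sum_limit)
    show "(\<lambda>n. real (k1 n) / real (m n)) \<longlonglongrightarrow> (1 - erf (\<nu>1 / sqrt 2)) / 2"
      unfolding q1 by (rule k1_m_lim)
    show "\<forall>\<^sub>F n in sequentially. \<forall>i\<in>{1..m n}. distributed (M n) lborel (h n i) std_normal_density"
      using n0 by eventually_elim (use h in blast)
    show "\<forall>\<^sub>F n in sequentially. prob_space.indep_vars (M n) (\<lambda>_. borel) (h n) {1..m n}"
      using n0 by eventually_elim (rule indh)
  qed (fact M' m_top k1m)+
  have T2: "T2 \<longlonglongrightarrow> std_normal_density \<nu>2"
    unfolding T2_def
  proof (rule top_sum_limit[where d = "\<lambda>n. n"])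
    show "(\<lambda>n. real (k2 n) / real n) \<longlonglongrightarrow> (1 - erf (\<nu>2 / sqrt 2)) / 2"
      unfolding q2 by (rule k2_lim)
    show "\<forall>\<^sub>F n in sequentially. \<forall>j\<in>{1..n}. distributed (M n) lborel (g n j) std_normal_density"
      using n0 by eventually_elim (use g in blast)
    show "\<forall>\<^sub>F n in sequentially. prob_space.indep_vars (M n) (\<lambda>_. borel) (g n) {1..n}"
      using n0 by eventually_elim (rule indg)
  qed (fact M' filterlim_ident k2n)+
  \<comment> \<open>All sizes are rewritten as ratios to \<open>n\<close>, whose limits are given;
    the factor \<open>sqrt n\<close> balances the remaining powers of \<open>n\<close>.\<close>
  have E_L_eq: "\<forall>\<^sub>F n in sequentially.
      1 / sqrt (real (k1 n) / real n * (real (k2 n) / real n)) *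
      (real (m n) / real n * T1 n / sqrt (real (k1 n) / real n) + T2 n / sqrt (real (k2 n) / real n)) =
      E_L n * sqrt (real n)"
    using n0 k1m k2n
  proof eventually_elim
    case (elim n)
    interpret prob_space "M n" using M elim by simp
    have p: "m n > 0" "k1 n > 0" "k2 n > 0" using pos elim by auto
    have int: "integrable (M n) (\<lambda>w. top_sum (m n) (k1 n) (\<lambda>i. h n i w))"
      "integrable (M n) (\<lambda>w. top_sum n (k2 n) (\<lambda>j. g n j w))"
      using elim p h g indh indg by (auto intro!: expectation_top_sum_bounds(1)[where \<eta> = 1])
    have "E_L n = 1 / sqrt (real (k1 n) * real (k2 n)) *
        (real (m n) * T1 n / sqrt (real (k1 n)) + real n * T2 n / sqrt (real (k2 n)))"
      unfolding E_L_def T1_def T2_def decoupled_max_eq_top_sum[OF p(2) elim(2) p(3) elim(3)]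
      using int p elim by simp
    also have "\<dots> * sqrt (real n) = 1 / sqrt (real (k1 n) / real n * (real (k2 n) / real n)) *
      (real (m n) / real n * T1 n / sqrt (real (k1 n) / real n) + T2 n / sqrt (real (k2 n) / real n))"
    proof -
      define r where "r = sqrt (real n)"
      have r: "r > 0" "real n = r * r" using elim by (auto simp: r_def)
      have eq: "1 / (a * b) * (c * s / a + r * r * t / b) * r =
          1 / (a / r * (b / r)) * (c / (r * r) * s / (a / r) + t / (b / r))"
        if "a > 0" "b > 0" for a b c s t
        using that r(1) by (simp add: field_simps)
      show ?thesis
        unfolding real_sqrt_mult real_sqrt_divide r_def[symmetric] unfolding r(2)
        by (rule eq) (use p in auto)
    qed
    finally show ?case by (rule sym)
  qed
  have "(\<lambda>n. 1 / sqrt (real (k1 n) / real n * (real (k2 n) / real n)) *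
      (real (m n) / real n * T1 n / sqrt (real (k1 n) / real n) + T2 n / sqrt (real (k2 n) / real n))) \<longlonglongrightarrow>
      1 / sqrt (\<beta>1 * \<beta>2) * (\<alpha> * std_normal_density \<nu>1 / sqrt \<beta>1 + std_normal_density \<nu>2 / sqrt \<beta>2)"
    using \<beta> by (intro tendsto_intros m_lim k1_lim k2_lim T1 T2) auto
  then have "(\<lambda>n. E_L n * sqrt (real n)) \<longlonglongrightarrow>
      1 / sqrt (\<beta>1 * \<beta>2) * (\<alpha> * std_normal_density \<nu>1 / sqrt \<beta>1 + std_normal_density \<nu>2 / sqrt \<beta>2)"
    by (rule Lim_transform_eventually[OF _ E_L_eq])
  also have "\<alpha> * std_normal_density \<nu>1 / sqrt \<beta>1 + std_normal_density \<nu>2 / sqrt \<beta>2 = ?\<omega>"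
    unfolding omega_hat[OF \<beta>] unfolding \<nu>1_def \<nu>2_def nu1_hat_def nu2_hat_def std_normal_density_sqrt2
    by (simp add: mult.commute)
  finally have lim: "(\<lambda>n. E_L n * sqrt (real n)) \<longlonglongrightarrow> 1 / sqrt (\<beta>1 * \<beta>2) * ?\<omega>" .
  have "\<forall>\<^sub>F n in sequentially. ereal (E_xi n * sqrt (real n)) \<le> ereal (E_L n * sqrt (real n))"
    using n0 k1m k2n
  proof eventually_elim
    case (elim n)
    interpret prob_space "M n" using M elim by simp
    have p: "k1 n > 0" "k2 n > 0" using pos elim by auto
    have "E_xi n \<le> E_L n"
      unfolding E_xi_def E_L_def
      by (rule expectation_max_avg_submatrix_le[OF p(1) elim(2) p(2) elim(3) A[OF elim(1)] h[OF elim(1)] g[OF elim(1)] ind[OF elim(1)]])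
    then show ?case by (simp add: mult_right_mono)
  qed
  then have "limsup (\<lambda>n. ereal (E_xi n * sqrt (real n))) \<le> limsup (\<lambda>n. ereal (E_L n * sqrt (real n)))"
    by (rule Limsup_mono)
  also have "\<dots> = ereal (1 / sqrt (\<beta>1 * \<beta>2) * ?\<omega>)"
    using lim by (intro lim_imp_Limsup) auto
  also have "1 / sqrt (\<beta>1 * \<beta>2) * ?\<omega> = lim (\<lambda>n. E_L n * sqrt (real n))"
    using limI[OF lim] by simp
  finally show ?thesis
    using lim omega_hat[OF \<beta>] by simp
qed

end
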